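(* Let $r\ge1$ be an integer, $\nu$ fixed with $\Re(\nu)>-\frac1{r+1}$, $a<b$, $f,g\in C^\infty[a,b]$, with $g(a)=0$, $g^{(j)}(a)=0$ for $j=1,\dots,r$, $g^{(r+1)}(a)\ne0$, and $g(x)\ne0$, $g'(x)\ne0$ for $x\in(a,b]$. Let $\mathcal{H}_\nu[f]=\int_a^bf(x)J_\nu(\omega g(x))\,dx$, $M_j(a,\nu,\omega)=\int_a^b(x-a)^jJ_\nu(\omega g(x))\,dx$, $T_r[\phi](x,y)=\sum_{j=0}^r\frac{\phi^{(j)}(y)}{j!}(x-y)^j$, $\widehat\sigma_0[f]=f$, $\widehat\sigma_k[f](x)=g(x)^{\nu+k}\frac{d}{dx}\left[\frac{\widehat\sigma_{k-1}[f](x)-T_r[\widehat\sigma_{k-1}[f]](x,a)}{g(x)^{\nu+k}g'(x)}\right]$ for $k\ge1$ (values at $a$ by continuous extension). For an integer $m\ge1$ let $$Q_m^A[f]=\sum_{k=0}^{m-1}\frac{1}{(-\omega)^k}\sum_{j=0}^r\frac{\widehat\sigma_k[f]^{(j)}(a)}{j!}M_j(a,\nu+k,\omega)-\sum_{k=1}^m\frac{1}{(-\omega)^k}\left[\frac{\widehat\sigma_{k-1}[f](b)-T_r[\widehat\sigma_{k-1}[f]](b,a)}{g'(b)}\right]J_{\nu+k}(\omega g(b)).$$ Then $\mathcal{H}_\nu[f]-Q_m^A[f]=\mathcal{O}(\omega^{-m-\frac1{r+1}})$ as $\omega\to\infty$.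
   Context: $J_\nu$ is the Bessel function of the first kind of order $\nu$. *)

theory Defs
  imports "HOL-Analysis.Analysis" "HOL-Library.Landau_Symbols"
begin

text \<open>Bessel function of the first kind, principal branch:
  J_nu(z) = (z/2)^nu * sum_m (-1)^m (z/2)^(2m) / (m! Gamma(m+nu+1)).
  At z = 0 we use the limiting value 1 for nu = 0 and 0 otherwise.\<close>
definition bessel_J :: "complex \<Rightarrow> complex \<Rightarrow> complex" where
  "bessel_J \<nu> z =
     (if z = 0 then (if \<nu> = 0 then 1 else 0)
      else (z / 2) powr \<nu> *
        (\<Sum>m. (-1) ^ m * (z / 2) ^ (2 * m) * rGamma (of_nat m + \<nu> + 1) / fact m))"

definition hderiv :: "real set \<Rightarrow> nat \<Rightarrow> (real \<Rightarrow> 'a::real_normed_vector) \<Rightarrow> real \<Rightarrow> 'a" where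
  "hderiv S n \<phi> = ((\<lambda>\<psi> x. vector_derivative \<psi> (at x within S)) ^^ n) \<phi>"

definition smooth_on :: "real set \<Rightarrow> (real \<Rightarrow> 'a::real_normed_vector) \<Rightarrow> bool" where
  "smooth_on S \<phi> \<longleftrightarrow>
     (\<forall>n. \<forall>x\<in>S. (hderiv S n \<phi> has_vector_derivative hderiv S (Suc n) \<phi> x) (at x within S))"

definition taylorT :: "real set \<Rightarrow> nat \<Rightarrow> (real \<Rightarrow> complex) \<Rightarrow> real \<Rightarrow> real \<Rightarrow> complex" where
  "taylorT S r \<phi> x y = (\<Sum>j\<le>r. hderiv S j \<phi> y / of_nat (fact j) * of_real ((x - y) ^ j))"

fun sigma_hat :: "real \<Rightarrow> real \<Rightarrow> nat \<Rightarrow> complex \<Rightarrow> (real \<Rightarrow> real) \<Rightarrow> nat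
                   \<Rightarrow> (real \<Rightarrow> complex) \<Rightarrow> real \<Rightarrow> complex" where
  "sigma_hat a b r \<nu> g 0 f = f"
| "sigma_hat a b r \<nu> g (Suc k) f =
     (let S = {a..b}; s = sigma_hat a b r \<nu> g k f; e = \<nu> + of_nat (Suc k);
          h = (\<lambda>t. (s t - taylorT S r s t a) /
                    (complex_of_real (g t) powr e * complex_of_real (hderiv S 1 g t)));
          F = (\<lambda>t. complex_of_real (g t) powr e * vector_derivative h (at t within S))
      in (\<lambda>x. if x = a then Lim (at_right a) F else F x))"

definition H_int :: "real \<Rightarrow> real \<Rightarrow> complex \<Rightarrow> (real \<Rightarrow> real) \<Rightarrow> (real \<Rightarrow> complex) \<Rightarrow> real \<Rightarrow> complex" where
  "H_int a b \<nu> g f \<omega> = integral {a..b} (\<lambda>x. f x * bessel_J \<nu> (of_real (\<omega> * g x)))"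

definition M_mom :: "real \<Rightarrow> real \<Rightarrow> (real \<Rightarrow> real) \<Rightarrow> nat \<Rightarrow> complex \<Rightarrow> real \<Rightarrow> complex" where
  "M_mom a b g j \<nu> \<omega> = integral {a..b} (\<lambda>x. of_real ((x - a) ^ j) * bessel_J \<nu> (of_real (\<omega> * g x)))"

definition QA :: "real \<Rightarrow> real \<Rightarrow> nat \<Rightarrow> complex \<Rightarrow> (real \<Rightarrow> real) \<Rightarrow> nat
                   \<Rightarrow> (real \<Rightarrow> complex) \<Rightarrow> real \<Rightarrow> complex" where
  "QA a b r \<nu> g m f \<omega> =
     (\<Sum>k<m. 1 / (- complex_of_real \<omega>) ^ k *
        (\<Sum>j\<le>r. hderiv {a..b} j (sigma_hat a b r \<nu> g k f) a / of_nat (fact j)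
                 * M_mom a b g j (\<nu> + of_nat k) \<omega>))
   - (\<Sum>k=1..m. 1 / (- complex_of_real \<omega>) ^ k *
        ((sigma_hat a b r \<nu> g (k - 1) f b
            - taylorT {a..b} r (sigma_hat a b r \<nu> g (k - 1) f) b a)
          / complex_of_real (hderiv {a..b} 1 g b))
        * bessel_J (\<nu> + of_nat k) (of_real (\<omega> * g b)))"

end

(* With \<sigma> = sigma_hat k and e = \<nu> + k + 1, the identity (x^e J_e)' = x^e J_{e-1} turns
   \<integral> (\<sigma> - T_r \<sigma>) J_{e-1}(\<omega> g), by one integration by parts, into a boundary term at b minus
   \<omega>^{-1} \<integral> \<sigma>' J_e(\<omega> g) with \<sigma>' = sigma_hat (k+1).  Since g = (x - a)^{r+1} w and
   g' = (x - a)^r v with v, w smooth and nonvanishing, and \<sigma> - T_r \<sigma> = (x - a)^{r+1} u by Hadamard's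
   lemma, \<sigma>' = ((x - a) u / v)' - e u / w is again smooth.  Iterating m times leaves
   (-\<omega>)^{-m} \<integral> sigma_hat m * J_{\<nu>+m}(\<omega> g).  This integral is O(\<omega>^{-1/(r+1)}): on [a, a + \<delta>] with
   \<delta> = \<omega>^{-1/(r+1)} the integrand is bounded, and on [a + \<delta>, b] a further integration by parts costs
   \<omega>^{-1} \<delta>^{-r} = \<delta>, again using only that J is bounded on the real line (J ~ x^{-1/2} alone
   would lose a logarithm for r = 1). *)

theory Submission
  imports Defs
begin

section \<open>Bessel functions of a real argument\<close>

text \<open>The sign of \<open>g\<close> on (a, b] is not prescribed, so Bessel functions and
  complex powers are needed at negative real arguments, on the cut of the principal branch, where
  complex differentiability fails. Along the negative half-line, however, the logarithm is ln |x|
  plus the constant i pi, so derivatives along the real line exist on both sides of 0 and have the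
  same form. The other obstacle is the endpoint a. For Re \<nu> < 0 the kernel is unbounded there,
  and the condition on Re \<nu> makes the integral converge; after one step the order has positive
  real part and boundedness of J suffices. Moreover \<open>sigma_hat\<close> at a is only a limit of
  expressions containing powers of \<open>g\<close>. These powers cancel, but the recursion can
  continue only if the result is known to be smooth on all of [a, b]. Hence every quotient is
  expressed through cofactors of powers of x - a.\<close>

definition bessel_series :: "complex \<Rightarrow> complex \<Rightarrow> complex" where
  "bessel_series \<mu> w = (\<Sum>m. ((-1) ^ m * rGamma (of_nat m + \<mu> + 1) / fact m) * w ^ m)"

text \<open>By 1/Gamma(z) = z/Gamma(z + 1), passing from term n to term n + 1 multiplies by -w / ((n
  + 1) z) with z = n + \<mu> + 1, so the ratio test applies.\<close>

lemma bessel_series_summable: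
  "summable (\<lambda>m. ((-1) ^ m * rGamma (of_nat m + \<mu> + 1) / fact m) * (w::complex) ^ m)"
proof -
  \<comment> \<open>Beyond this \<open>N\<close> both |n + \<mu> + 1| \<ge> 1 and |w| / (n + 1)
    \<le> 1/2 hold.\<close>
  obtain N :: nat where N: "real N \<ge> norm \<mu> + 1 + 2 * norm w"
    using real_arch_simple by blast
  show ?thesis
  proof (rule summable_ratio_test[where c = "1/2" and N = N])
    fix n assume n: "N \<le> n"
    let ?z = "of_nat n + \<mu> + 1"
    have nN: "real n \<ge> norm \<mu> + 1 + 2 * norm w" using N n by linarith
    have z1: "norm ?z \<ge> 1"
    proof -
      have "real n + 1 \<le> norm ?z + norm \<mu>"
        using norm_triangle_ineq4[of ?z \<mu>] norm_of_nat[of "Suc n", where 'a=complex]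
        by (simp add: algebra_simps del: norm_of_nat)
      then show ?thesis using nN norm_ge_zero[of w] by linarith
    qed
    have rg: "?z * rGamma (of_nat (Suc n) + \<mu> + 1) = rGamma ?z"
      using rGamma_plus1[of ?z] by (simp add: algebra_simps)
    have "norm (rGamma (of_nat (Suc n) + \<mu> + 1)) \<le> norm ?z * norm (rGamma (of_nat (Suc n) + \<mu> + 1))"
      using z1 by (intro mult_le_cancel_right1[THEN iffD2]) auto
    also have "\<dots> = norm (rGamma ?z)" using rg by (metis norm_mult)
    finally have A: "norm (rGamma (of_nat (Suc n) + \<mu> + 1)) \<le> norm (rGamma ?z)" .
    have B: "norm w / real (Suc n) \<le> 1/2"
    proof -
      have "2 * norm w \<le> real (Suc n)"
        using nN norm_ge_zero[of \<mu>] by linarith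
      then show ?thesis by (simp add: field_simps)
    qed
    have "norm ((-1) ^ Suc n * rGamma (of_nat (Suc n) + \<mu> + 1) / fact (Suc n) * w ^ Suc n)
       = (norm w / real (Suc n)) * (norm (rGamma (of_nat (Suc n) + \<mu> + 1)) * norm w ^ n / fact n)"
      by (simp add: norm_mult norm_divide norm_power del: of_nat_Suc)
    also have "\<dots> \<le> (1/2) * (norm (rGamma ?z) * norm w ^ n / fact n)"
      by (intro mult_mono B divide_right_mono mult_right_mono A) auto
    also have "\<dots> = 1/2 * norm ((-1) ^ n * rGamma ?z / fact n * w ^ n)"
      by (simp add: norm_mult norm_divide norm_power)
    finally show "norm ((-1) ^ Suc n * rGamma (of_nat (Suc n) + \<mu> + 1) / fact (Suc n) * w ^ Suc n)
       \<le> 1/2 * norm ((-1) ^ n * rGamma ?z / fact n * w ^ n)" .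
  qed simp
qed

text \<open>Up to the sign of its argument \<open>bessel_series\<close> is the Bessel-Clifford
  function, for which differentiation raises the order: the factor n + 1 cancels in the factorial,
  and the shift of the index is absorbed into \<mu>.\<close>

lemma DERIV_bessel_series:
  "(bessel_series \<mu> has_field_derivative - bessel_series (\<mu> + 1) w) (at w)"
proof -
  let ?c = "\<lambda>m. (-1) ^ m * rGamma (of_nat m + \<mu> + 1) / (fact m :: complex)"
  have "((\<lambda>x. \<Sum>n. ?c n * x ^ n) has_field_derivative (\<Sum>n. diffs ?c n * w ^ n)) (at w)"
    by (rule termdiffs_strong[of _ "of_real (norm w + 1)"])
       (use bessel_series_summable in auto)
  also have "(\<Sum>n. diffs ?c n * w ^ n) = (\<Sum>n. - (((-1) ^ n * rGamma (of_nat n + (\<mu> + 1) + 1) / fact n) * w ^ n))"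
  proof (rule suminf_cong)
    fix n
    have e: "of_nat (Suc n) + \<mu> + 1 = of_nat n + (\<mu> + 1) + 1" by simp
    have "diffs ?c n = - ((-1) ^ n * rGamma (of_nat n + (\<mu> + 1) + 1) / fact n)"
      unfolding diffs_def e by (simp del: of_nat_Suc)
    then show "diffs ?c n * w ^ n = - (((-1) ^ n * rGamma (of_nat n + (\<mu> + 1) + 1) / fact n) * w ^ n)"
      by simp
  qed
  also have "\<dots> = - bessel_series (\<mu> + 1) w"
    unfolding bessel_series_def by (rule suminf_minus[OF bessel_series_summable])
  finally show ?thesis unfolding bessel_series_def[abs_def] by simp
qed

lemma continuous_on_bessel_series [continuous_intros]:
  assumes "continuous_on S h"
  shows "continuous_on S (\<lambda>x. bessel_series \<mu> (h x))"
proof -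
  have "continuous_on UNIV (bessel_series \<mu>)"
    by (intro continuous_at_imp_continuous_on ballI DERIV_isCont[OF DERIV_bessel_series])
  then show ?thesis
    using assms by (rule continuous_on_compose2) auto
qed

text \<open>This is J_{\<mu>-1} + J_{\<mu>+1} = (2 \<mu> / z) J_\<mu> freed of the powers of z; it
  follows by comparing coefficients, using the functional equation of 1/Gamma.\<close>

lemma bessel_series_rec:
  "bessel_series (\<mu> - 1) w = \<mu> * bessel_series \<mu> w - w * bessel_series (\<mu> + 1) w"
proof -
  let ?t = "\<lambda>\<mu> m. ((-1) ^ m * rGamma (of_nat m + \<mu> + 1) / fact m) * (w::complex) ^ m"
  let ?d = "\<lambda>m. ?t (\<mu> - 1) m - \<mu> * ?t \<mu> m"
  have sd: "summable ?d"
    by (intro summable_diff summable_mult bessel_series_summable)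
  \<comment> \<open>The constant terms agree, so the difference series can be shifted by one index;
    this produces the factor \<open>w\<close>.\<close>
  have d0: "?d 0 = 0"
    using rGamma_plus1[of \<mu>] by simp
  have dS: "?d (Suc n) = - w * ?t (\<mu> + 1) n" for n
  proof -
    let ?z = "of_nat n + \<mu> + 1"
    have "rGamma ?z = ?z * rGamma (?z + 1)"
      by (simp only: rGamma_plus1)
    then have *: "rGamma ?z - \<mu> * rGamma (?z + 1) = (of_nat n + 1) * rGamma (?z + 1)"
      by (simp add: algebra_simps)
    have e: "of_nat (Suc n) + (\<mu> - 1) + 1 = ?z" "of_nat (Suc n) + \<mu> + 1 = ?z + 1"
      "of_nat n + (\<mu> + 1) + 1 = ?z + 1" by simp_all
    have dist: "A * X / F * W - \<mu> * (A * Y / F * W) = A * W / F * (X - \<mu> * Y)" for A X F W Y :: complex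
      by (cases "F = 0") (auto simp: field_simps)
    have "?d (Suc n) = (-1) ^ Suc n * w ^ Suc n / fact (Suc n) * ((of_nat n + 1) * rGamma (?z + 1))"
      unfolding e dist * ..
    also have "\<dots> = (-1) ^ Suc n * w ^ Suc n / (of_nat (Suc n) * fact n) * (of_nat (Suc n) * rGamma (?z + 1))"
      by (simp add: add_ac)
    also have "\<dots> = - w * ?t (\<mu> + 1) n"
      unfolding e by (simp del: of_nat_Suc)
    finally show ?thesis .
  qed
  have "suminf ?d = bessel_series (\<mu> - 1) w - \<mu> * bessel_series \<mu> w"
    unfolding bessel_series_def
    unfolding suminf_mult[OF bessel_series_summable, symmetric]
    by (rule suminf_diff[symmetric]) (intro summable_mult bessel_series_summable)+
  moreover have "suminf ?d = (\<Sum>n. ?d (Suc n))"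
    using suminf_split_head[OF sd] d0 by simp
  moreover have "(\<Sum>n. ?d (Suc n)) = - w * bessel_series (\<mu> + 1) w"
    unfolding dS bessel_series_def by (rule suminf_mult[OF bessel_series_summable])
  ultimately show ?thesis by (simp add: algebra_simps)
qed

section \<open>Recurrence, reflection and derivatives of Bessel functions\<close>

lemma bessel_J_nonzero:
  "z \<noteq> 0 \<Longrightarrow> bessel_J \<mu> z = (z / 2) powr \<mu> * bessel_series \<mu> (z\<^sup>2 / 4)"
  using power_mult[of "z / 2" 2]
  by (simp add: bessel_J_def bessel_series_def power_divide mult_ac)

lemma bessel_J_rec:
  assumes "z \<noteq> 0"
  shows "bessel_J (\<mu> - 1) z = 2 * \<mu> / z * bessel_J \<mu> z - bessel_J (\<mu> + 1) z"
  using assms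
  by (simp add: bessel_J_nonzero bessel_series_rec[of \<mu>] powr_diff powr_add field_simps power2_eq_square)

text \<open>The principal logarithm of -x is ln x + i pi, and the series factor depends only on the
  square of the argument. All statements about negative arguments are reduced to positive ones by
  this rule.\<close>

lemma bessel_J_minus:
  assumes "x > 0"
  shows "bessel_J \<mu> (of_real (- x)) = exp (\<i> * pi * \<mu>) * bessel_J \<mu> (of_real x)"
proof -
  have "Ln (complex_of_real (- x / 2)) = ln (x / 2) + \<i> * pi"
    using assms Ln_minus[of "complex_of_real (x/2)"] Ln_of_real[of "x/2"] by simp
  moreover have "Ln (complex_of_real (x / 2)) = ln (x / 2)"
    using assms Ln_of_real[of "x/2"] by simp
  ultimately have "(of_real (- x) / 2) powr \<mu> = exp (\<i> * pi * \<mu>) * (of_real x / 2) powr \<mu>"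
    using assms by (simp add: powr_def algebra_simps exp_add)
  then show ?thesis using assms by (simp add: bessel_J_nonzero)
qed

lemma bessel_J_has_vector_derivative_pos:
  assumes "x > 0"
  shows "((\<lambda>x. bessel_J \<mu> (of_real x)) has_vector_derivative
           (\<mu> / of_real x * bessel_J \<mu> (of_real x) - bessel_J (\<mu> + 1) (of_real x))) (at x)"
proof -
  let ?z = "complex_of_real x"
  have z: "?z \<notin> \<real>\<^sub>\<le>\<^sub>0" "?z \<noteq> 0" using assms by auto
  have "((\<lambda>z. (z/2) powr \<mu> * bessel_series \<mu> (z\<^sup>2/4)) has_field_derivative
      (\<mu> * (?z/2) powr (\<mu> - 1) * (1/2)) * bessel_series \<mu> (?z\<^sup>2/4)
       + (- bessel_series (\<mu> + 1) (?z\<^sup>2/4) * (?z / 2)) * (?z/2) powr \<mu>) (at ?z)"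
  proof (rule DERIV_mult)
    show "((\<lambda>z. (z/2) powr \<mu>) has_field_derivative (\<mu> * (?z/2) powr (\<mu> - 1) * (1/2))) (at ?z)"
      by (rule DERIV_chain2[OF has_field_derivative_powr])
         (use assms in \<open>auto simp: complex_nonpos_Reals_iff intro!: derivative_eq_intros\<close>)
    show "((\<lambda>z. bessel_series \<mu> (z\<^sup>2/4)) has_field_derivative (- bessel_series (\<mu> + 1) (?z\<^sup>2/4) * (?z / 2))) (at ?z)"
      by (rule DERIV_chain2[OF DERIV_bessel_series]) (auto intro!: derivative_eq_intros)
  qed
  then have "((\<lambda>z. (z/2) powr \<mu> * bessel_series \<mu> (z\<^sup>2/4)) has_field_derivative
      \<mu> / ?z * bessel_J \<mu> ?z - bessel_J (\<mu> + 1) ?z) (at ?z)"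
    by (rule back_subst[of "\<lambda>d. (_ has_field_derivative d) _"])
       (use z in \<open>simp add: bessel_J_nonzero powr_diff powr_add field_simps\<close>)
  then have "((\<lambda>x. (of_real x/2) powr \<mu> * bessel_series \<mu> ((of_real x)\<^sup>2/4)) has_vector_derivative
      \<mu> / ?z * bessel_J \<mu> ?z - bessel_J (\<mu> + 1) ?z) (at x)"
    by (rule has_vector_derivative_real_field)
  then show ?thesis
    by (rule has_vector_derivative_transform_within_open[where S="{0<..}"])
       (use assms in \<open>auto simp: bessel_J_nonzero\<close>)
qed

text \<open>The order-lowering form of J'. On the negative half-line the cut rules out
  differentiating in the complex plane, so the formula is carried over by reflection.\<close>

lemma bessel_J_has_vector_derivative:
  assumes "x \<noteq> 0"
  shows "((\<lambda>x. bessel_J \<mu> (of_real x)) has_vector_derivative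
           (bessel_J (\<mu> - 1) (of_real x) - \<mu> / of_real x * bessel_J \<mu> (of_real x))) (at x)"
proof (cases "x > 0")
  case True
  show ?thesis
    by (rule has_vector_derivative_eq_rhs[OF bessel_J_has_vector_derivative_pos[OF True]])
       (use bessel_J_rec[of "of_real x" \<mu>] True in simp)
next
  case False
  define y where "y = - x"
  have y: "y > 0" using False assms by (simp add: y_def)
  have "((\<lambda>x. bessel_J \<mu> (of_real x)) has_vector_derivative
           (bessel_J (\<mu> - 1) (of_real y) - \<mu> / of_real y * bessel_J \<mu> (of_real y))) (at y)"
    by (rule has_vector_derivative_eq_rhs[OF bessel_J_has_vector_derivative_pos[OF y]])
       (use bessel_J_rec[of "of_real y" \<mu>] y in simp)
  then have "((\<lambda>x. bessel_J \<mu> (of_real (- x))) has_vector_derivative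
           -(bessel_J (\<mu> - 1) (of_real y) - \<mu> / of_real y * bessel_J \<mu> (of_real y))) (at x)"
    using vector_diff_chain_at[of uminus "-1" x "\<lambda>x. bessel_J \<mu> (of_real x)"]
      has_vector_derivative_minus[OF has_vector_derivative_id[of "at x"]]
    unfolding o_def y_def scaleR_minus1_left by blast
  then have "((\<lambda>x. exp (\<i> * pi * \<mu>) * bessel_J \<mu> (of_real (- x))) has_vector_derivative
      exp (\<i> * pi * \<mu>) * -(bessel_J (\<mu> - 1) (of_real y) - \<mu> / of_real y * bessel_J \<mu> (of_real y))) (at x)"
    by (rule has_vector_derivative_mult_right)
  \<comment> \<open>Lowering the order by one multiplies exp (i pi \<mu>) by -1, which offsets the
    sign of the inner derivative.\<close>
  also have "exp (\<i> * pi * \<mu>) * -(bessel_J (\<mu> - 1) (of_real y) - \<mu> / of_real y * bessel_J \<mu> (of_real y))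
     = bessel_J (\<mu> - 1) (of_real x) - \<mu> / of_real x * bessel_J \<mu> (of_real x)"
    using bessel_J_minus[OF y, of \<mu>] bessel_J_minus[OF y, of "\<mu> - 1"] y
    by (simp add: y_def algebra_simps exp_diff)
  finally show ?thesis
    by (rule has_vector_derivative_transform_within_open[where S="{..<0}"])
       (use y in \<open>auto simp: y_def bessel_J_minus[of "- z" for z, simplified]\<close>)
qed

lemma continuous_on_bessel_J [continuous_intros]:
  assumes "continuous_on S h" "\<And>x. x \<in> S \<Longrightarrow> h x \<noteq> (0::real)"
  shows "continuous_on S (\<lambda>x. bessel_J \<mu> (of_real (h x)))"
proof -
  have "continuous_on (- {0::real}) (\<lambda>x. bessel_J \<mu> (of_real x))"
    by (intro continuous_at_imp_continuous_on ballI
         has_vector_derivative_continuous[OF bessel_J_has_vector_derivative]) auto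
  then show ?thesis
    by (rule continuous_on_compose2[OF _ assms(1)]) (use assms(2) in auto)
qed

text \<open>For real \<open>x \<ge> 1\<close> the energy \<open>\<bar>y\<bar>\<^sup>2 + \<bar>y'\<bar>\<^sup>2\<close> of \<open>y = sqrt x * J(x)\<close>,
  which solves \<open>y'' = - (1 - (\<mu>\<^sup>2 - 1/4) / x\<^sup>2) y\<close>, stays bounded by Gronwall.\<close>

lemma bessel_J_bounded_ge_1:
  "\<exists>C. \<forall>x\<ge>1. norm (bessel_J \<mu> (of_real x)) \<le> C"
proof -
  define c where "c = \<mu>\<^sup>2 - 1/4"
  define y where "y = (\<lambda>x. of_real (sqrt x) * bessel_J \<mu> (of_real x))"
  \<comment> \<open>\<open>p\<close> is y' written out with the order-raising formula for
    J'.\<close>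
  define p where "p = (\<lambda>x. (\<mu> + 1/2) * (of_real (1 / sqrt x) * bessel_J \<mu> (of_real x))
     - of_real (sqrt x) * bessel_J (\<mu> + 1) (of_real x))"
  have sq: "((\<lambda>x. complex_of_real (sqrt x)) has_vector_derivative of_real (1 / (2 * sqrt x))) (at x)"
    if "x > 0" for x
    using that by (intro has_vector_derivative_of_real)
      (auto intro!: derivative_eq_intros simp: has_real_derivative_iff_has_vector_derivative[symmetric] field_simps)
  have isq: "((\<lambda>x. complex_of_real (1 / sqrt x)) has_vector_derivative of_real (- 1 / (2 * x * sqrt x))) (at x)"
    if "x > 0" for x
    using that by (intro has_vector_derivative_of_real)
      (auto intro!: derivative_eq_intros simp: has_real_derivative_iff_has_vector_derivative[symmetric] field_simps)
  have dy: "(y has_vector_derivative p x) (at x)" if "x > 0" for x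
  proof -
    define R where "R = complex_of_real (sqrt x)"
    have R: "R \<noteq> 0" "complex_of_real x = R * R"
      using that by (auto simp: R_def simp flip: of_real_mult)
    show ?thesis
      unfolding y_def
      by (rule has_vector_derivative_eq_rhs[OF has_vector_derivative_mult[OF sq[OF that]
              bessel_J_has_vector_derivative_pos[OF that]]])
         (use R(1) in \<open>simp add: p_def R(2) R_def[symmetric] field_simps\<close>)
  qed
  have dp: "(p has_vector_derivative (c / of_real (x\<^sup>2) - 1) * y x) (at x)" if "x > 0" for x
  proof -
    define R where "R = complex_of_real (sqrt x)"
    have R: "R \<noteq> 0" "complex_of_real x = R * R"
      using that by (auto simp: R_def simp flip: of_real_mult)
    \<comment> \<open>The order-lowering formula returns from \<mu> + 1 to \<mu>, so that p' is a
      multiple of y alone.\<close>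
    have J1: "((\<lambda>x. bessel_J (\<mu> + 1) (of_real x)) has_vector_derivative
           (bessel_J \<mu> (of_real x) - (\<mu> + 1) / of_real x * bessel_J (\<mu> + 1) (of_real x))) (at x)"
      using bessel_J_has_vector_derivative[of x "\<mu> + 1"] that by simp
    show ?thesis
      unfolding p_def
      by (rule has_vector_derivative_eq_rhs[OF has_vector_derivative_diff[OF
            has_vector_derivative_mult_right[OF has_vector_derivative_mult[OF isq[OF that]
              bessel_J_has_vector_derivative_pos[OF that]]]
            has_vector_derivative_mult[OF sq[OF that] J1]]])
         (use R(1) in \<open>simp add: c_def y_def R(2) R_def[symmetric] divide_simps,
             simp add: algebra_simps power2_eq_square power4_eq_xxxx\<close>)
  qed
  define E where "E = (\<lambda>x. y x \<bullet> y x + p x \<bullet> p x)"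
  \<comment> \<open>In E' the products of y and p with coefficients 2 and -2 cancel; only the
    perturbation c / x^2 survives.\<close>
  have dE: "(E has_real_derivative (2 * (p x \<bullet> (c / of_real (x\<^sup>2) * y x)))) (at x)" if "x > 0" for x
    unfolding E_def has_real_derivative_iff_has_vector_derivative
    by (rule has_vector_derivative_eq_rhs[OF has_vector_derivative_add[OF
          bounded_bilinear.has_vector_derivative[OF bounded_bilinear_inner dy[OF that] dy[OF that]]
          bounded_bilinear.has_vector_derivative[OF bounded_bilinear_inner dp[OF that] dp[OF that]]]])
       (simp add: left_diff_distrib inner_diff_left inner_diff_right
          inner_commute[of _ "p x"])
  have Epos: "E x \<ge> 0" for x by (simp add: E_def)
  have bd: "2 * (p x \<bullet> (c / of_real (x\<^sup>2) * y x)) \<le> norm c / x\<^sup>2 * E x" for x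
  proof -
    have "p x \<bullet> (c / of_real (x\<^sup>2) * y x) \<le> norm (p x) * norm (c / of_real (x\<^sup>2) * y x)"
      by (rule norm_cauchy_schwarz)
    also have "\<dots> = norm c / x\<^sup>2 * (norm (p x) * norm (y x))"
      by (simp add: norm_mult norm_divide norm_power)
    finally have "2 * (p x \<bullet> (c / of_real (x\<^sup>2) * y x)) \<le> norm c / x\<^sup>2 * (2 * norm (p x) * norm (y x))"
      by (simp only: mult.assoc mult.left_commute[of _ 2])
    also have "\<dots> \<le> norm c / x\<^sup>2 * E x"
      using sum_squares_bound[of "norm (p x)" "norm (y x)"]
      by (intro mult_left_mono) (auto simp: E_def power2_norm_eq_inner)
    finally show ?thesis .
  qed
  \<comment> \<open>The Gronwall factor exp (|c| / x) has logarithmic derivative - |c| / x^2 and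
    stays between 1 and exp |c| for x \<ge> 1.\<close>
  have mono: "E x * exp (norm c / x) \<le> E 1 * exp (norm c / 1)" if "x \<ge> 1" for x
  proof (rule DERIV_nonpos_imp_nonincreasing[OF that])
    fix t :: real assume t: "1 \<le> t" "t \<le> x"
    have "((\<lambda>x. E x * exp (norm c / x)) has_real_derivative
       (2 * (p t \<bullet> (c / of_real (t\<^sup>2) * y t)) - norm c / t\<^sup>2 * E t) * exp (norm c / t)) (at t)"
    proof -
      have "((\<lambda>x. exp (norm c / x)) has_real_derivative (exp (norm c / t) * (- norm c / t\<^sup>2))) (at t)"
        using t by (auto intro!: derivative_eq_intros simp: power2_eq_square)
      from DERIV_mult[OF dE this] show ?thesis
        by (rule back_subst[of "\<lambda>d. (_ has_real_derivative d) _"])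
           (use t in \<open>simp_all add: algebra_simps\<close>)
    qed
    moreover have "(2 * (p t \<bullet> (c / of_real (t\<^sup>2) * y t)) - norm c / t\<^sup>2 * E t) * exp (norm c / t) \<le> 0"
      using bd[of t] by (intro mult_nonpos_nonneg) auto
    ultimately show "\<exists>d. ((\<lambda>x. E x * exp (norm c / x)) has_real_derivative d) (at t) \<and> d \<le> 0" by blast
  qed
  have "norm (bessel_J \<mu> (of_real x)) \<le> sqrt (E 1 * exp (norm c))" if "x \<ge> 1" for x
  proof -
    \<comment> \<open>Here the decay x^(-1/2) of J is given away in favour of mere
      boundedness.\<close>
    have "(norm (bessel_J \<mu> (of_real x)))\<^sup>2 \<le> x * (norm (bessel_J \<mu> (of_real x)))\<^sup>2"
      using that by (simp add: mult_le_cancel_right1)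
    also have "\<dots> = (norm (y x))\<^sup>2"
      using that by (simp add: y_def norm_mult power_mult_distrib)
    also have "\<dots> \<le> E x" by (simp add: E_def power2_norm_eq_inner)
    also have "\<dots> \<le> E x * exp (norm c / x)"
      using Epos[of x] that by (simp add: mult_le_cancel_left1)
    also have "\<dots> \<le> E 1 * exp (norm c)" using mono[OF that] by simp
    finally show ?thesis by (rule real_le_rsqrt)
  qed
  then show ?thesis by blast
qed

text \<open>The power (x / 2)^\<mu> carries the whole behaviour at 0, since the entire factor is
  bounded on compact sets. For Re \<mu> < 0 this measures the singularity of the integrand.\<close>

lemma bessel_J_local_bound:
  obtains K where "K \<ge> 0"
    "\<And>x::real. x \<noteq> 0 \<Longrightarrow> \<bar>x\<bar> \<le> R \<Longrightarrow> norm (bessel_J \<mu> (of_real x)) \<le> K * \<bar>x / 2\<bar> powr Re \<mu>"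
proof -
  have "compact ((\<lambda>x. bessel_series \<mu> ((complex_of_real x)\<^sup>2/4)) ` {-R..R})"
    by (intro compact_continuous_image continuous_intros) auto
  then obtain C where C: "\<And>x. x \<in> {-R..R} \<Longrightarrow> norm (bessel_series \<mu> ((complex_of_real x)\<^sup>2/4)) \<le> C"
    using bounded_iff[THEN iffD1, OF compact_imp_bounded] by fast
  have pos: "norm (bessel_J \<mu> (of_real x)) \<le> max 0 C * (x / 2) powr Re \<mu>" if "x > 0" "\<bar>x\<bar> \<le> R" for x
  proof -
    have "norm ((complex_of_real x / 2) powr \<mu>) = (x/2) powr Re \<mu>"
      using that norm_powr_real_powr[of "of_real x/2" \<mu>] by simp
    moreover have "norm (bessel_series \<mu> ((complex_of_real x)\<^sup>2/4)) \<le> max 0 C"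
      using that C[of x] by auto
    ultimately have "norm ((complex_of_real x / 2) powr \<mu> * bessel_series \<mu> ((complex_of_real x)\<^sup>2/4))
        \<le> (x / 2) powr Re \<mu> * max 0 C"
      unfolding norm_mult by (metis mult_left_mono powr_ge_zero)
    then show ?thesis
      using that by (subst bessel_J_nonzero) (simp_all add: mult.commute)
  qed
  \<comment> \<open>E = exp (- pi Im \<mu>) may lie on either side of 1, hence the maximum
    below.\<close>
  define E where "E = norm (exp (\<i> * pi * \<mu>))"
  have E: "E \<ge> 0" by (simp add: E_def)
  show ?thesis
  proof (rule that[of "max 1 E * max 0 C"])
    show "0 \<le> max 1 E * max 0 C" by simp
    fix x :: real assume x: "x \<noteq> 0" "\<bar>x\<bar> \<le> R"
    have "norm (bessel_J \<mu> (of_real x)) \<le> max 1 E * norm (bessel_J \<mu> (of_real \<bar>x\<bar>))"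
    proof (cases "x > 0")
      case True
      then show ?thesis using mult_right_mono[of 1 "max 1 E" "norm (bessel_J \<mu> (of_real x))"] by simp
    next
      case False
      then have "norm (bessel_J \<mu> (of_real x)) = E * norm (bessel_J \<mu> (of_real \<bar>x\<bar>))"
        using bessel_J_minus[of "-x" \<mu>] x by (simp add: E_def norm_mult)
      then show ?thesis using mult_right_mono[of E "max 1 E" "norm (bessel_J \<mu> (of_real \<bar>x\<bar>))"] by simp
    qed
    also have "\<dots> \<le> max 1 E * (max 0 C * (\<bar>x\<bar> / 2) powr Re \<mu>)"
      using pos[of "\<bar>x\<bar>"] x by (intro mult_left_mono) auto
    finally show "norm (bessel_J \<mu> (of_real x)) \<le> max 1 E * max 0 C * \<bar>x / 2\<bar> powr Re \<mu>"
      by (simp add: mult.assoc)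
  qed
qed

lemma bessel_J_bounded:
  assumes "Re \<mu> \<ge> 0"
  obtains C where "C \<ge> 0" "\<And>x::real. norm (bessel_J \<mu> (of_real x)) \<le> C"
proof -
  obtain C1 where C1: "\<And>x. x \<ge> 1 \<Longrightarrow> norm (bessel_J \<mu> (of_real x)) \<le> C1"
    using bessel_J_bounded_ge_1 by blast
  obtain C2 where C2: "C2 \<ge> 0"
    "\<And>x::real. x \<noteq> 0 \<Longrightarrow> \<bar>x\<bar> \<le> 1 \<Longrightarrow> norm (bessel_J \<mu> (of_real x)) \<le> C2 * \<bar>x / 2\<bar> powr Re \<mu>"
    using bessel_J_local_bound[of 1 \<mu>] by blast
  have small: "norm (bessel_J \<mu> (of_real x)) \<le> C2" if "x > 0" "x \<le> 1" for x
  proof -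
    have "\<bar>x / 2\<bar> powr Re \<mu> \<le> 1" using that assms by (intro powr_le1) auto
    then have "C2 * \<bar>x / 2\<bar> powr Re \<mu> \<le> C2" using C2(1) mult_left_mono by fastforce
    then show ?thesis using C2(2)[of x] that by auto
  qed
  \<comment> \<open>The 1 covers x = 0, where \<open>bessel_J\<close> takes the conventional value 0
    or 1.\<close>
  define C where "C = max 1 (max C1 C2)"
  have pos: "norm (bessel_J \<mu> (of_real x)) \<le> C" if "x > 0" for x
    using C1[of x] small[of x] that by (cases "x \<ge> 1") (auto simp: C_def)
  have neg: "norm (bessel_J \<mu> (of_real x)) \<le> norm (exp (\<i> * pi * \<mu>)) * C" if "x < 0" for x
    using bessel_J_minus[of "-x" \<mu>] pos[of "-x"] that
    by (auto simp: norm_mult intro!: mult_left_mono)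
  show ?thesis
  proof (rule that[of "max C (norm (exp (\<i> * pi * \<mu>)) * C)"])
    show "0 \<le> max C (norm (exp (\<i> * pi * \<mu>)) * C)" by (simp add: C_def le_max_iff_disj)
    fix x :: real
    consider "x > 0" | "x < 0" | "x = 0" by linarith
    then show "norm (bessel_J \<mu> (of_real x)) \<le> max C (norm (exp (\<i> * pi * \<mu>)) * C)"
    proof cases
      case 3
      have "C \<ge> 1" by (simp add: C_def)
      then show ?thesis using 3 by (simp add: bessel_J_def le_max_iff_disj)
    qed (use pos neg in \<open>auto simp: le_max_iff_disj\<close>)
  qed
qed

section \<open>Smooth functions on an interval\<close>

text \<open>Leaving the derivatives existential lets products and quotients be treated by induction
  on the order, without formulas for their iterated derivatives.\<close>

primrec differentiable_upto :: "nat \<Rightarrow> real set \<Rightarrow> (real \<Rightarrow> 'a::real_normed_vector) \<Rightarrow> bool" where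
  "differentiable_upto 0 S \<phi> \<longleftrightarrow> True"
| "differentiable_upto (Suc k) S \<phi> \<longleftrightarrow>
     (\<exists>\<phi>'. (\<forall>x\<in>S. (\<phi> has_vector_derivative \<phi>' x) (at x within S)) \<and> differentiable_upto k S \<phi>')"

lemma differentiable_upto_Suc_imp:
  "differentiable_upto (Suc k) S \<phi> \<Longrightarrow> differentiable_upto k S \<phi>"
proof (induction k arbitrary: \<phi>)
  case (Suc k)
  obtain \<phi>' where D: "\<forall>x\<in>S. (\<phi> has_vector_derivative \<phi>' x) (at x within S)" "differentiable_upto (Suc k) S \<phi>'"
    using Suc.prems unfolding differentiable_upto.simps(2)[of "Suc k"] by blast
  show ?case
    unfolding differentiable_upto.simps(2)[of k] using D(1) Suc.IH[OF D(2)] by blast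
qed simp

lemma differentiable_upto_cong:
  assumes "differentiable_upto k S \<phi>" "\<And>x. x \<in> S \<Longrightarrow> \<psi> x = \<phi> x"
  shows "differentiable_upto k S \<psi>"
proof (cases k)
  case (Suc j)
  obtain \<phi>' where D: "\<forall>x\<in>S. (\<phi> has_vector_derivative \<phi>' x) (at x within S)" "differentiable_upto j S \<phi>'"
    using assms(1) unfolding Suc differentiable_upto.simps(2) by blast
  have "(\<psi> has_vector_derivative \<phi>' x) (at x within S)" if "x \<in> S" for x
    by (rule has_vector_derivative_transform[OF that assms(2) D(1)[rule_format, OF that]])
  then show ?thesis
    unfolding Suc differentiable_upto.simps(2) using D(2) by blast
qed simp

lemma differentiable_upto_hderiv:
  "smooth_on S \<phi> \<Longrightarrow> differentiable_upto k S (hderiv S n \<phi>)"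
proof (induction k arbitrary: n)
  case (Suc k)
  show ?case
    unfolding differentiable_upto.simps(2)
    using Suc.prems Suc.IH[OF Suc.prems, of "Suc n"] unfolding smooth_on_def
    by (intro exI[of _ "hderiv S (Suc n) \<phi>"]) simp
qed simp

lemma hderiv_0: "hderiv S 0 \<phi> = \<phi>"
  by (simp add: hderiv_def)

lemma hderiv_Suc: "hderiv S (Suc n) \<phi> x = vector_derivative (hderiv S n \<phi>) (at x within S)"
  by (simp add: hderiv_def)

lemma vector_derivative_Icc_eq:
  assumes "a < b" "x \<in> {a..b}" "(\<phi> has_vector_derivative d) (at x within {a..b})"
  shows "vector_derivative \<phi> (at x within {a..b}) = (d::'a::real_normed_vector)"
  using vector_derivative_within_cbox[of a b x \<phi> d] assms by simp

text \<open>On a nondegenerate interval derivatives within the interval are unique, also at the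
  endpoints, so any existential witness agrees with \<open>vector_derivative\<close>.\<close>

lemma smooth_on_Icc_iff:
  assumes "a < b"
  shows "smooth_on {a..b} \<phi> \<longleftrightarrow> (\<forall>k. differentiable_upto k {a..b} \<phi>)"
proof
  assume "smooth_on {a..b} \<phi>"
  then show "\<forall>k. differentiable_upto k {a..b} \<phi>"
    using differentiable_upto_hderiv[of "{a..b}" \<phi> _ 0] by (auto simp: hderiv_0)
next
  assume *: "\<forall>k. differentiable_upto k {a..b} \<phi>"
  have step: "(\<psi> has_vector_derivative vector_derivative \<psi> (at x within {a..b})) (at x within {a..b})"
    if du: "differentiable_upto (Suc k) {a..b} \<psi>" and x: "x \<in> {a..b}" for \<psi> :: "real \<Rightarrow> 'a" and k x
  proof -
    obtain d where "(\<psi> has_vector_derivative d) (at x within {a..b})"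
      using du x unfolding differentiable_upto.simps(2) by blast
    then show ?thesis
      using vector_derivative_Icc_eq[OF assms x, of \<psi> d] by simp
  qed
  have step2: "differentiable_upto k {a..b} (\<lambda>x. vector_derivative \<psi> (at x within {a..b}))"
    if du: "differentiable_upto (Suc k) {a..b} \<psi>" for \<psi> :: "real \<Rightarrow> 'a" and k
  proof -
    obtain \<psi>' where D: "\<And>x. x \<in> {a..b} \<Longrightarrow> (\<psi> has_vector_derivative \<psi>' x) (at x within {a..b})"
      "differentiable_upto k {a..b} \<psi>'"
      using du unfolding differentiable_upto.simps(2) by blast
    show ?thesis
      by (rule differentiable_upto_cong[OF D(2)]) (rule vector_derivative_Icc_eq[OF assms _ D(1)])
  qed
  have all: "differentiable_upto k {a..b} (hderiv {a..b} n \<phi>)" for k n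
  proof (induction n arbitrary: k)
    case 0
    then show ?case using * by (simp add: hderiv_0)
  next
    case (Suc n)
    show ?case using step2[OF Suc.IH[of "Suc k"]] by (simp add: hderiv_Suc[abs_def])
  qed
  show "smooth_on {a..b} \<phi>"
    unfolding smooth_on_def hderiv_Suc by (intro allI ballI step[OF all])
qed

lemma smooth_on_derivative:
  "smooth_on S \<phi> \<Longrightarrow> smooth_on S (hderiv S 1 \<phi>)"
  unfolding smooth_on_def
proof (intro allI ballI)
  fix n x assume *: "\<forall>n. \<forall>x\<in>S. (hderiv S n \<phi> has_vector_derivative hderiv S (Suc n) \<phi> x) (at x within S)" and x: "x \<in> S"
  have "hderiv S n (hderiv S 1 \<phi>) = hderiv S (Suc n) \<phi>" for n
    by (simp add: hderiv_def funpow_Suc_right del: funpow.simps(2))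
  then show "(hderiv S n (hderiv S 1 \<phi>) has_vector_derivative hderiv S (Suc n) (hderiv S 1 \<phi>) x) (at x within S)"
    using * x by simp
qed

lemma smooth_on_has_vector_derivative:
  "smooth_on S \<phi> \<Longrightarrow> x \<in> S \<Longrightarrow> (\<phi> has_vector_derivative hderiv S 1 \<phi> x) (at x within S)"
  unfolding smooth_on_def using hderiv_0[of S \<phi>] by (auto dest!: spec[of _ 0])

lemma smooth_on_imp_continuous_on: "smooth_on S \<phi> \<Longrightarrow> continuous_on S \<phi>"
  unfolding continuous_on_eq_continuous_within
  by (intro ballI has_vector_derivative_continuous[OF smooth_on_has_vector_derivative])

lemma differentiable_upto_const: "differentiable_upto k S (\<lambda>x. c)"
proof (induction k arbitrary: c)
  case (Suc k)
  show ?case using Suc[of 0] by (auto intro!: exI[of _ "\<lambda>x. 0"])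
qed simp

lemma differentiable_upto_add:
  "differentiable_upto k S \<phi> \<Longrightarrow> differentiable_upto k S \<psi> \<Longrightarrow> differentiable_upto k S (\<lambda>x. \<phi> x + \<psi> x)"
proof (induction k arbitrary: \<phi> \<psi>)
  case (Suc k)
  then obtain \<phi>' \<psi>' where "\<And>x. x \<in> S \<Longrightarrow> (\<phi> has_vector_derivative \<phi>' x) (at x within S)" "differentiable_upto k S \<phi>'"
   "\<And>x. x \<in> S \<Longrightarrow> (\<psi> has_vector_derivative \<psi>' x) (at x within S)" "differentiable_upto k S \<psi>'"
    unfolding differentiable_upto.simps(2) by blast
  then show ?case
    using Suc.IH by (auto intro!: exI[of _ "\<lambda>x. \<phi>' x + \<psi>' x"] has_vector_derivative_add)
qed simp

lemma differentiable_upto_mult: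
  fixes \<phi> \<psi> :: "real \<Rightarrow> 'a::real_normed_algebra"
  shows "differentiable_upto k S \<phi> \<Longrightarrow> differentiable_upto k S \<psi> \<Longrightarrow> differentiable_upto k S (\<lambda>x. \<phi> x * \<psi> x)"
proof (induction k arbitrary: \<phi> \<psi>)
  case (Suc k)
  then obtain \<phi>' \<psi>' where D: "\<And>x. x \<in> S \<Longrightarrow> (\<phi> has_vector_derivative \<phi>' x) (at x within S)" "differentiable_upto k S \<phi>'"
   "\<And>x. x \<in> S \<Longrightarrow> (\<psi> has_vector_derivative \<psi>' x) (at x within S)" "differentiable_upto k S \<psi>'"
    unfolding differentiable_upto.simps(2) by blast
  have "differentiable_upto k S (\<lambda>x. \<phi> x * \<psi>' x + \<phi>' x * \<psi> x)"
    using Suc.prems[THEN differentiable_upto_Suc_imp] D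
    by (intro differentiable_upto_add Suc.IH)
  then show ?case
    using D by (auto intro!: exI[of _ "\<lambda>x. \<phi> x * \<psi>' x + \<phi>' x * \<psi> x"] has_vector_derivative_mult)
qed simp

text \<open>The derivative - \<phi>' (1/\<phi>)^2 involves only \<phi>' and 1/\<phi> itself, so the
  induction closes through the product rule.\<close>

lemma differentiable_upto_inverse:
  fixes \<phi> :: "real \<Rightarrow> 'a::real_normed_field"
  assumes nz: "\<And>x. x \<in> S \<Longrightarrow> \<phi> x \<noteq> 0"
  shows "differentiable_upto k S \<phi> \<Longrightarrow> differentiable_upto k S (\<lambda>x. inverse (\<phi> x))"
proof (induction k)
  case (Suc k)
  then obtain \<phi>' where D: "\<And>x. x \<in> S \<Longrightarrow> (\<phi> has_vector_derivative \<phi>' x) (at x within S)" "differentiable_upto k S \<phi>'"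
    unfolding differentiable_upto.simps(2) by blast
  have "differentiable_upto k S (\<lambda>x. (- 1) * (\<phi>' x * (inverse (\<phi> x) * inverse (\<phi> x))))"
    using Suc.IH[OF differentiable_upto_Suc_imp[OF Suc.prems]] D(2)
    by (intro differentiable_upto_mult differentiable_upto_const)
  moreover have "((\<lambda>x. inverse (\<phi> x)) has_vector_derivative (- 1) * (\<phi>' x * (inverse (\<phi> x) * inverse (\<phi> x)))) (at x within S)"
    if "x \<in> S" for x
  proof -
    have "((\<lambda>x. inverse (\<phi> x)) has_derivative (\<lambda>h. - (inverse (\<phi> x) * (h *\<^sub>R \<phi>' x) * inverse (\<phi> x)))) (at x within S)"
      using D(1)[OF that] nz[OF that] unfolding has_vector_derivative_def
      by (intro Deriv.has_derivative_inverse)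
    then show ?thesis
      unfolding has_vector_derivative_def by (rule back_subst[of "\<lambda>d. (_ has_derivative d) _"])
        (simp add: fun_eq_iff mult_ac)
  qed
  ultimately show ?case
    unfolding differentiable_upto.simps(2)
    by (intro exI[of _ "\<lambda>x. (- 1) * (\<phi>' x * (inverse (\<phi> x) * inverse (\<phi> x)))"] conjI ballI)
qed simp

section \<open>Smoothness on a nondegenerate interval and smooth Taylor remainders\<close>

context
  fixes a b :: real
  assumes ab: "a < b"
begin

lemma smooth_on_const: "smooth_on {a..b} (\<lambda>x. c)"
  by (simp add: smooth_on_Icc_iff[OF ab] differentiable_upto_const)

lemma smooth_on_add:
  "smooth_on {a..b} \<phi> \<Longrightarrow> smooth_on {a..b} \<psi> \<Longrightarrow> smooth_on {a..b} (\<lambda>x. \<phi> x + \<psi> x)"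
  by (simp add: smooth_on_Icc_iff[OF ab] differentiable_upto_add)

lemma smooth_on_mult:
  fixes \<phi> \<psi> :: "real \<Rightarrow> 'a::real_normed_algebra"
  shows "smooth_on {a..b} \<phi> \<Longrightarrow> smooth_on {a..b} \<psi> \<Longrightarrow> smooth_on {a..b} (\<lambda>x. \<phi> x * \<psi> x)"
  by (simp add: smooth_on_Icc_iff[OF ab] differentiable_upto_mult)

lemma smooth_on_divide:
  fixes \<phi> \<psi> :: "real \<Rightarrow> 'a::real_normed_field"
  assumes "smooth_on {a..b} \<phi>" "smooth_on {a..b} \<psi>" "\<And>x. x \<in> {a..b} \<Longrightarrow> \<psi> x \<noteq> 0"
  shows "smooth_on {a..b} (\<lambda>x. \<phi> x / \<psi> x)"
  unfolding smooth_on_Icc_iff[OF ab] divide_inverse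
proof
  show "differentiable_upto k {a..b} (\<lambda>x. \<phi> x * inverse (\<psi> x))" for k
    using assms(1,2) unfolding smooth_on_Icc_iff[OF ab]
    by (intro differentiable_upto_mult differentiable_upto_inverse assms(3)) auto
qed

lemma smooth_on_cong:
  "smooth_on {a..b} \<phi> \<Longrightarrow> (\<And>x. x \<in> {a..b} \<Longrightarrow> \<psi> x = \<phi> x) \<Longrightarrow> smooth_on {a..b} \<psi>"
  by (metis differentiable_upto_cong smooth_on_Icc_iff[OF ab])

lemma smooth_on_linear: "smooth_on {a..b} (\<lambda>x. of_real (x - a) :: 'a::real_normed_algebra_1)"
  unfolding smooth_on_Icc_iff[OF ab]
proof
  have "((\<lambda>x. of_real (x - a) :: 'a) has_vector_derivative 1) (at x within {a..b})" for x
    unfolding has_vector_derivative_def scaleR_conv_of_real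
    by (auto intro!: derivative_eq_intros)
  then show "differentiable_upto k {a..b} (\<lambda>x. of_real (x - a) :: 'a)" for k
    by (cases k) (auto intro!: exI[of _ "\<lambda>x. 1"] simp: differentiable_upto_const simp del: of_real_diff)
qed

text \<open>Computes iterated derivatives from any chain of candidates \<open>D\<close>; it serves
  for real functions viewed as complex ones and for the parameter integral in
  \<open>Hadamard\<close>.\<close>

lemma hderiv_unique:
  assumes "\<And>n x. x \<in> {a..b} \<Longrightarrow> (D n has_vector_derivative D (Suc n) x) (at x within {a..b})"
    and "\<And>x. x \<in> {a..b} \<Longrightarrow> \<phi> x = D 0 x" and "x \<in> {a..b}"
  shows "hderiv {a..b} n \<phi> x = D n x"
  using assms(3)
proof (induction n arbitrary: x)
  case 0
  then show ?case unfolding hderiv_0 by (rule assms(2))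
next
  case (Suc n)
  have "(hderiv {a..b} n \<phi> has_vector_derivative D (Suc n) x) (at x within {a..b})"
    using Suc.prems Suc.IH assms(1)[OF Suc.prems] by (rule has_vector_derivative_transform)
  then show ?case
    unfolding hderiv_Suc by (rule vector_derivative_Icc_eq[OF ab Suc.prems])
qed

lemma smooth_onI:
  assumes "\<And>n x. x \<in> {a..b} \<Longrightarrow> (D n has_vector_derivative D (Suc n) x) (at x within {a..b})"
    and "\<And>x. x \<in> {a..b} \<Longrightarrow> \<phi> x = D 0 x"
  shows "smooth_on {a..b} \<phi>"
  unfolding smooth_on_def
proof (intro allI ballI)
  fix n x assume x: "x \<in> {a..b}"
  have e: "\<And>n x. x \<in> {a..b} \<Longrightarrow> hderiv {a..b} n \<phi> x = D n x"
    by (rule hderiv_unique[where D=D]) (use assms in auto)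
  show "(hderiv {a..b} n \<phi> has_vector_derivative hderiv {a..b} (Suc n) \<phi> x) (at x within {a..b})"
    unfolding e[OF x, of "Suc n"] using x e assms(1)[OF x] by (rule has_vector_derivative_transform)
qed

lemma hderiv_of_real:
  assumes "smooth_on {a..b} g" "x \<in> {a..b}"
  shows "hderiv {a..b} n (\<lambda>x. complex_of_real (g x)) x = of_real (hderiv {a..b} n g x)"
  by (rule hderiv_unique[where D = "\<lambda>n x. of_real (hderiv {a..b} n g x)"])
     (use assms in \<open>auto simp: smooth_on_def hderiv_0 has_real_derivative_iff_has_vector_derivative intro!: has_vector_derivative_of_real\<close>)

lemma smooth_on_of_real:
  assumes "smooth_on {a..b} g"
  shows "smooth_on {a..b} (\<lambda>x. complex_of_real (g x))"
  by (rule smooth_onI[where D = "\<lambda>n x. of_real (hderiv {a..b} n g x)"])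
     (use assms in \<open>auto simp: smooth_on_def hderiv_0 has_real_derivative_iff_has_vector_derivative intro!: has_vector_derivative_of_real\<close>)

text \<open>The quotient is \<open>\<integral>\<^sub>0\<^sup>1 \<phi>'(a + t (x - a)) dt\<close>, which may be differentiated under the integral.\<close>

lemma Hadamard:
  fixes \<phi> :: "real \<Rightarrow> complex"
  assumes sm: "smooth_on {a..b} \<phi>"
  obtains u where "smooth_on {a..b} u"
    "\<And>x. x \<in> {a..b} \<Longrightarrow> \<phi> x = \<phi> a + of_real (x - a) * u x"
    "\<And>n. hderiv {a..b} n u a = hderiv {a..b} (Suc n) \<phi> a / of_nat (Suc n)"
proof -
  \<comment> \<open>Each differentiation in x brings out one factor t. At x = a the integral reduces
    to that of t^n, which explains the divisor n + 1 in the derivatives of u at a.\<close>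
  define D where "D = (\<lambda>n x. integral {0..1} (\<lambda>t. of_real (t ^ n) * hderiv {a..b} (Suc n) \<phi> (a + t * (x - a))))"
  have seg: "a + t * (x - a) \<in> {a..b}" if "x \<in> {a..b}" "t \<in> {0..1}" for x t
    using that mult_left_le_one_le[of "x - a" t] by auto
  have cont: "continuous_on {a..b} (hderiv {a..b} n \<phi>)" for n
    unfolding continuous_on_eq_continuous_within
    by (intro ballI has_vector_derivative_continuous[OF sm[unfolded smooth_on_def, rule_format]])
  have contc: "continuous_on ({a..b} \<times> {0..1}) (\<lambda>(x, t). of_real (t ^ k) * hderiv {a..b} n \<phi> (a + t * (x - a)))" for n k
    unfolding split_beta
    by (intro continuous_intros continuous_on_compose2[OF cont]) (use seg in auto)
  have DD: "(D n has_vector_derivative D (Suc n) x) (at x within {a..b})" if x: "x \<in> {a..b}" for n x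
  proof -
    have "((\<lambda>x. integral (cbox 0 1) (\<lambda>t. of_real (t ^ n) * hderiv {a..b} (Suc n) \<phi> (a + t * (x - a))))
      has_vector_derivative integral (cbox 0 1) (\<lambda>t. of_real (t ^ Suc n) * hderiv {a..b} (Suc (Suc n)) \<phi> (a + t * (x - a))))
      (at x within {a..b})"
    proof (rule leibniz_rule_vector_derivative)
      fix x t :: real assume xt: "x \<in> {a..b}" "t \<in> cbox 0 1"
      have "((\<lambda>x. a + t * (x - a)) has_vector_derivative t) (at x within {a..b})"
        by (auto intro!: derivative_eq_intros simp: has_real_derivative_iff_has_vector_derivative[symmetric])
      moreover have "(hderiv {a..b} (Suc n) \<phi> has_vector_derivative hderiv {a..b} (Suc (Suc n)) \<phi> (a + t * (x - a)))
         (at (a + t * (x - a)) within (\<lambda>x. a + t * (x - a)) ` {a..b})"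
        by (rule has_vector_derivative_within_subset[where S="{a..b}"])
           (use sm seg xt in \<open>auto simp: smooth_on_def\<close>)
      ultimately have "((hderiv {a..b} (Suc n) \<phi> \<circ> (\<lambda>x. a + t * (x - a))) has_vector_derivative
         t *\<^sub>R hderiv {a..b} (Suc (Suc n)) \<phi> (a + t * (x - a))) (at x within {a..b})"
        by (rule vector_diff_chain_within)
      then have "((\<lambda>x. of_real (t ^ n) * hderiv {a..b} (Suc n) \<phi> (a + t * (x - a))) has_vector_derivative
         of_real (t ^ n) * (t *\<^sub>R hderiv {a..b} (Suc (Suc n)) \<phi> (a + t * (x - a)))) (at x within {a..b})"
        by (intro has_vector_derivative_mult_right) (simp add: o_def)
      then show "((\<lambda>x. of_real (t ^ n) * hderiv {a..b} (Suc n) \<phi> (a + t * (x - a))) has_vector_derivative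
         of_real (t ^ Suc n) * hderiv {a..b} (Suc (Suc n)) \<phi> (a + t * (x - a))) (at x within {a..b})"
        by (simp add: scaleR_conv_of_real mult_ac)
    next
      fix x assume "x \<in> {a..b}"
      then show "(\<lambda>t. complex_of_real (t ^ n) * hderiv {a..b} (Suc n) \<phi> (a + t * (x - a))) integrable_on cbox 0 1"
        by (intro integrable_continuous continuous_intros continuous_on_compose2[OF cont])
           (use seg in auto)
    next
      show "continuous_on ({a..b} \<times> cbox 0 1) (\<lambda>(x, t). complex_of_real (t ^ Suc n) * hderiv {a..b} (Suc (Suc n)) \<phi> (a + t * (x - a)))"
        using contc[of "Suc n" "Suc (Suc n)"] by simp
    qed (use x in auto)
    then show ?thesis by (simp add: D_def)
  qed
  show ?thesis
  proof (rule that[of "D 0"])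
    show "smooth_on {a..b} (D 0)" by (rule smooth_onI[where D=D]) (use DD in auto)
    show "\<phi> x = \<phi> a + of_real (x - a) * D 0 x" if x: "x \<in> {a..b}" for x
    proof -
      have "((\<lambda>t. (x - a) *\<^sub>R hderiv {a..b} 1 \<phi> (a + t * (x - a))) has_integral
          (\<phi> (a + 1 * (x - a)) - \<phi> (a + 0 * (x - a)))) {0..1}"
      proof (rule fundamental_theorem_of_calculus)
        fix t :: real assume t: "t \<in> {0..1}"
        have "((\<lambda>t. a + t * (x - a)) has_vector_derivative (x - a)) (at t within {0..1})"
          by (auto intro!: derivative_eq_intros simp: has_real_derivative_iff_has_vector_derivative[symmetric])
        moreover have "(\<phi> has_vector_derivative hderiv {a..b} 1 \<phi> (a + t * (x - a)))
           (at (a + t * (x - a)) within (\<lambda>t. a + t * (x - a)) ` {0..1})"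
          by (rule has_vector_derivative_within_subset[where S="{a..b}"])
             (use sm seg x t in \<open>auto intro!: smooth_on_has_vector_derivative simp del: One_nat_def\<close>)
        ultimately have "((\<phi> \<circ> (\<lambda>t. a + t * (x - a))) has_vector_derivative
         (x - a) *\<^sub>R hderiv {a..b} 1 \<phi> (a + t * (x - a))) (at t within {0..1})"
          by (rule vector_diff_chain_within)
        then show "((\<lambda>t. \<phi> (a + t * (x - a))) has_vector_derivative
         (x - a) *\<^sub>R hderiv {a..b} 1 \<phi> (a + t * (x - a))) (at t within {0..1})"
          by (simp add: o_def)
      qed simp
      then have "integral {0..1} (\<lambda>t. (x - a) *\<^sub>R hderiv {a..b} 1 \<phi> (a + t * (x - a)))
          = \<phi> (a + 1 * (x - a)) - \<phi> (a + 0 * (x - a))"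
        by (rule integral_unique)
      moreover have "of_real (x - a) * D 0 x = (x - a) *\<^sub>R D 0 x"
        by (simp add: scaleR_conv_of_real)
      moreover have "(x - a) *\<^sub>R D 0 x = integral {0..1} (\<lambda>t. (x - a) *\<^sub>R hderiv {a..b} 1 \<phi> (a + t * (x - a)))"
        by (simp add: D_def)
      ultimately show ?thesis by simp
    qed
    show "hderiv {a..b} n (D 0) a = hderiv {a..b} (Suc n) \<phi> a / of_nat (Suc n)" for n
    proof -
      have "hderiv {a..b} n (D 0) a = D n a"
        by (rule hderiv_unique[where D=D]) (use DD ab in auto)
      also have "\<dots> = integral {0..1} (\<lambda>t. of_real (t ^ n)) * hderiv {a..b} (Suc n) \<phi> a"
        unfolding D_def by simp
      also have "integral {0..1} (\<lambda>t. complex_of_real (t ^ n)) = 1 / of_nat (Suc n)"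
      proof -
        have "((\<lambda>t::real. t ^ n) has_integral (1 ^ Suc n / real (Suc n) - 0 ^ Suc n / real (Suc n))) {0..1}"
          by (rule fundamental_theorem_of_calculus)
             (auto intro!: derivative_eq_intros simp: has_real_derivative_iff_has_vector_derivative[symmetric] simp del: power_Suc of_nat_Suc)
        then have "((\<lambda>t::real. complex_of_real (t ^ n)) has_integral of_real (1 / real (Suc n))) {0..1}"
          by (intro has_integral_of_real) simp
        then show ?thesis by (simp add: integral_unique)
      qed
      finally show ?thesis by simp
    qed
  qed
qed

text \<open>Iterating \<open>Hadamard\<close> divides out one factor x - a at a time and keeps the
  cofactor smooth up to and including a, which a mere size estimate of the remainder would not
  give.\<close>

lemma Taylor_smooth_remainder:
  fixes \<phi> :: "real \<Rightarrow> complex"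
  assumes "smooth_on {a..b} \<phi>"
  shows "\<exists>u. smooth_on {a..b} u \<and> u a = hderiv {a..b} n \<phi> a / of_nat (fact n) \<and>
    (\<forall>x\<in>{a..b}. \<phi> x = (\<Sum>j<n. hderiv {a..b} j \<phi> a / of_nat (fact j) * of_real ((x - a) ^ j)) + of_real ((x - a) ^ n) * u x)"
  using assms
proof (induction n arbitrary: \<phi>)
  case 0
  then show ?case by (intro exI[of _ \<phi>]) (simp add: hderiv_0)
next
  case (Suc n)
  obtain u where u: "smooth_on {a..b} u"
    "\<And>x. x \<in> {a..b} \<Longrightarrow> \<phi> x = \<phi> a + of_real (x - a) * u x"
    "\<And>n. hderiv {a..b} n u a = hderiv {a..b} (Suc n) \<phi> a / of_nat (Suc n)"
    using Hadamard[OF Suc.prems] by blast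
  obtain v where v: "smooth_on {a..b} v" "v a = hderiv {a..b} n u a / of_nat (fact n)"
    "\<And>x. x \<in> {a..b} \<Longrightarrow> u x = (\<Sum>j<n. hderiv {a..b} j u a / of_nat (fact j) * of_real ((x - a) ^ j)) + of_real ((x - a) ^ n) * v x"
    using Suc.IH[OF u(1)] by blast
  show ?case
  proof (intro exI[of _ v] conjI ballI v(1))
    show "v a = hderiv {a..b} (Suc n) \<phi> a / of_nat (fact (Suc n))"
      unfolding v(2) u(3) by (simp add: field_simps)
    fix x assume x: "x \<in> {a..b}"
    define X where "X = complex_of_real (x - a)"
    \<comment> \<open>The divisors j + 1 supplied by \<open>Hadamard\<close> turn j! into (j +
      1)!.\<close>
    have "X * (\<Sum>j<n. hderiv {a..b} j u a / of_nat (fact j) * X ^ j)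
       = (\<Sum>j<n. hderiv {a..b} (Suc j) \<phi> a / of_nat (fact (Suc j)) * X ^ Suc j)"
      unfolding sum_distrib_left u(3) by (intro sum.cong) (auto simp: field_simps)
    then show "\<phi> x = (\<Sum>j<Suc n. hderiv {a..b} j \<phi> a / of_nat (fact j) * of_real ((x - a) ^ j)) + of_real ((x - a) ^ Suc n) * v x"
      unfolding sum.lessThan_Suc_shift u(2)[OF x] v(3)[OF x] of_real_power X_def[symmetric]
      by (simp add: hderiv_0 distrib_left mult.assoc)
  qed
qed

end

section \<open>Oscillatory integrals with a degenerate phase\<close>

lemma continuous_on_Icc_bounded:
  fixes \<phi> :: "real \<Rightarrow> 'a::real_normed_vector"
  assumes "continuous_on {a..b} \<phi>"
  obtains C where "C \<ge> 0" "\<And>x. x \<in> {a..b} \<Longrightarrow> norm (\<phi> x) \<le> C"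
proof -
  have "bounded (\<phi> ` {a..b})"
    by (intro compact_imp_bounded compact_continuous_image assms compact_Icc)
  then obtain C where "\<And>x. x \<in> {a..b} \<Longrightarrow> norm (\<phi> x) \<le> C"
    unfolding bounded_iff by fast
  then show ?thesis by (intro that[of "max 0 C"]) (auto simp: le_max_iff_disj)
qed

text \<open>Since p + 1 > 0, the antiderivative is continuous up to a although the integrand may
  blow up there.\<close>

lemma integrable_on_powr_shift:
  fixes a b p :: real
  assumes "a \<le> b" "p > -1"
  shows "(\<lambda>x. (x - a) powr p) integrable_on {a..b}"
proof -
  have "((\<lambda>x. (x - a) powr p) has_integral
      ((b - a) powr (p + 1) / (p + 1) - (a - a) powr (p + 1) / (p + 1))) {a..b}"
  proof (rule fundamental_theorem_of_calculus_interior[OF assms(1)])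
    show "continuous_on {a..b} (\<lambda>x. (x - a) powr (p + 1) / (p + 1))"
      using assms by (intro continuous_intros continuous_on_powr') auto
    fix x assume "x \<in> {a<..<b}"
    then show "((\<lambda>x. (x - a) powr (p + 1) / (p + 1)) has_vector_derivative (x - a) powr p) (at x)"
      using assms unfolding has_real_derivative_iff_has_vector_derivative[symmetric]
      by (auto intro!: derivative_eq_intros)
  qed
  then show ?thesis by blast
qed

lemma DERIV_inverse_power_shift:
  fixes a x :: real
  assumes "x \<noteq> a"
  shows "((\<lambda>x. 1 / (x - a) ^ r) has_real_derivative - real r / (x - a) ^ Suc r) (at x within S)"
proof -
  have "((\<lambda>x. (x - a) ^ r) has_real_derivative real r * (x - a) ^ (r - 1)) (at x within S)"
    by (auto intro!: derivative_eq_intros)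
  from DERIV_divide[OF DERIV_const[of 1] this] assms
  have "((\<lambda>x. 1 / (x - a) ^ r) has_real_derivative
      (0 * (x - a) ^ r - 1 * (real r * (x - a) ^ (r - 1))) / ((x - a) ^ r * (x - a) ^ r)) (at x within S)"
    by simp
  then show ?thesis
    by (rule DERIV_cong) (use assms in \<open>cases r; simp add: divide_simps\<close>)
qed

text \<open>On each half-line Ln is ln |x| plus a constant, so the usual formula survives on the
  cut. This handles the powers of \<open>g\<close> in \<open>sigma_hat\<close> when \<open>g\<close>
  is negative.\<close>

lemma of_real_powr_has_vector_derivative:
  fixes x :: real
  assumes "x \<noteq> 0"
  shows "((\<lambda>x. complex_of_real x powr e) has_vector_derivative e / of_real x * of_real x powr e) (at x)"
proof -
  define S :: "real set" where "S = (if x > 0 then {0<..} else {..<0})"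
  define c :: complex where "c = (if x > 0 then 0 else \<i> * pi)"
  have S: "open S" "x \<in> S" using assms by (auto simp: S_def)
  have eq: "complex_of_real y powr e = exp (e * (of_real (ln \<bar>y\<bar>) + c))" if "y \<in> S" for y
  proof (cases "x > 0")
    case True
    then show ?thesis using that by (auto simp: S_def c_def powr_def Ln_of_real)
  next
    case False
    then have y: "y < 0" using that by (auto simp: S_def)
    then have "Ln (complex_of_real y) = ln \<bar>y\<bar> + \<i> * pi"
      using Ln_minus[of "complex_of_real (-y)"] Ln_of_real[of "-y"] by simp
    then show ?thesis using False y by (auto simp: c_def powr_def)
  qed
  have "((\<lambda>y. ln \<bar>y\<bar>) has_real_derivative 1 / x) (at x)"
  proof (cases "x > 0")
    case True
    then have "(ln has_real_derivative 1 / x) (at x)"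
      using DERIV_ln_divide by blast
    then show ?thesis
      by (rule has_field_derivative_transform_within_open[where S = S]) (use S True in \<open>auto simp: S_def\<close>)
  next
    case False
    then have "((\<lambda>y. ln (- y)) has_real_derivative 1 / x) (at x)"
      using assms by (auto intro!: derivative_eq_intros)
    then show ?thesis
      by (rule has_field_derivative_transform_within_open[where S = S]) (use S False in \<open>auto simp: S_def\<close>)
  qed
  then have "((\<lambda>y. complex_of_real (ln \<bar>y\<bar>)) has_vector_derivative of_real (1 / x)) (at x)"
    by (intro has_vector_derivative_of_real) (simp add: has_real_derivative_iff_has_vector_derivative)
  then have "((\<lambda>y. e * (complex_of_real (ln \<bar>y\<bar>) + c)) has_vector_derivative e * (of_real (1 / x) + 0)) (at x)"
    by (intro has_vector_derivative_mult_right has_vector_derivative_add has_vector_derivative_const)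
  from field_vector_diff_chain_at[OF this DERIV_exp]
  have "((\<lambda>y. exp (e * (complex_of_real (ln \<bar>y\<bar>) + c))) has_vector_derivative
      e / of_real x * of_real x powr e) (at x)"
    by (simp add: o_def eq[OF S(2)])
  then show ?thesis
    by (rule has_vector_derivative_transform_within_open[OF _ S]) (simp add: eq)
qed

text \<open>Records the phase through its zero of order r + 1 and that of its derivative of order r
  at a. The essential point is that the cofactors do not vanish at a either; the sign of
  \<open>g\<close> stays open.\<close>

locale bessel_phase =
  fixes a b :: real and r :: nat and g :: "real \<Rightarrow> real" and v w :: "real \<Rightarrow> complex"
  assumes ab: "a < b" and r: "1 \<le> r"
    and smooth_g: "smooth_on {a..b} g"
    and smooth_v: "smooth_on {a..b} v" and smooth_w: "smooth_on {a..b} w"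
    and v_nz: "\<And>x. x \<in> {a..b} \<Longrightarrow> v x \<noteq> 0" and w_nz: "\<And>x. x \<in> {a..b} \<Longrightarrow> w x \<noteq> 0"
    and g_eq: "\<And>x. x \<in> {a..b} \<Longrightarrow> of_real (g x) = of_real ((x - a) ^ Suc r) * w x"
    and g'_eq: "\<And>x. x \<in> {a..b} \<Longrightarrow> of_real (hderiv {a..b} 1 g x) = of_real ((x - a) ^ r) * v x"
begin

abbreviation g' :: "real \<Rightarrow> real" where "g' \<equiv> hderiv {a..b} 1 g"

lemma g_nz: "x \<in> {a<..b} \<Longrightarrow> g x \<noteq> 0"
  using g_eq[of x] w_nz[of x] by (auto simp del: of_real_mult of_real_power)

lemma g'_nz: "x \<in> {a<..b} \<Longrightarrow> g' x \<noteq> 0"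
  using g'_eq[of x] v_nz[of x] by (auto simp del: of_real_mult of_real_power)

lemma g_has_vector_derivative: "x \<in> {a..b} \<Longrightarrow> (g has_vector_derivative g' x) (at x within {a..b})"
  using smooth_on_has_vector_derivative[OF smooth_g] .

lemma continuous_g: "continuous_on {a..b} g"
  using smooth_on_imp_continuous_on[OF smooth_g] .

text \<open>Differentiating q J_e instead of (q g^(-e)) (g^e J_e) avoids complex powers of
  \<open>g\<close>. The price is the term e q g' / g, whose behaviour at a is governed by the choice
  of q.\<close>

lemma bessel_phase_has_vector_derivative:
  assumes "x \<in> {a<..b}" "\<omega> \<noteq> 0" and q: "(q has_vector_derivative q') (at x within {a..b})"
  shows "((\<lambda>x. q x * bessel_J e (of_real (\<omega> * g x))) has_vector_derivative
     (q' - e * (q x * of_real (g' x) / of_real (g x))) * bessel_J e (of_real (\<omega> * g x))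
       + of_real \<omega> * (q x * of_real (g' x)) * bessel_J (e - 1) (of_real (\<omega> * g x))) (at x within {a..b})"
proof -
  have nz: "\<omega> * g x \<noteq> 0" using assms g_nz by simp
  have "((\<lambda>x. \<omega> * g x) has_vector_derivative \<omega> * g' x) (at x within {a..b})"
    using assms by (intro has_vector_derivative_mult_right g_has_vector_derivative) auto
  from vector_diff_chain_within[OF this
      has_vector_derivative_at_within[OF bessel_J_has_vector_derivative[OF nz, of e]]]
  have "((\<lambda>x. bessel_J e (of_real (\<omega> * g x))) has_vector_derivative
     (\<omega> * g' x) *\<^sub>R (bessel_J (e - 1) (of_real (\<omega> * g x)) - e / of_real (\<omega> * g x) * bessel_J e (of_real (\<omega> * g x))))
     (at x within {a..b})"
    by (simp add: o_def)
  from has_vector_derivative_mult[OF q this] show ?thesis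
    by (rule has_vector_derivative_eq_rhs)
       (use nz in \<open>simp add: scaleR_conv_of_real field_simps\<close>)
qed

lemma bessel_phase_by_parts:
  assumes c: "c \<in> {a..b}" "\<omega> \<noteq> 0"
    and q: "\<And>x. x \<in> {c<..b} \<Longrightarrow> (q has_vector_derivative q' x) (at x within {a..b})"
    and F: "\<And>x. x \<in> {c<..<b} \<Longrightarrow> F x = (q' x - e * (q x * of_real (g' x) / of_real (g x))) * bessel_J e (of_real (\<omega> * g x))
       + of_real \<omega> * (q x * of_real (g' x)) * bessel_J (e - 1) (of_real (\<omega> * g x))"
    and cont: "((\<lambda>x. q x * bessel_J e (of_real (\<omega> * g x))) \<longlongrightarrow> q c * bessel_J e (of_real (\<omega> * g c))) (at c within {c..b})"
  shows "(F has_integral (q b * bessel_J e (of_real (\<omega> * g b)) - q c * bessel_J e (of_real (\<omega> * g c)))) {c..b}"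
proof (rule fundamental_theorem_of_calculus_interior)
  show "c \<le> b" using c by simp
  note D = bessel_phase_has_vector_derivative[OF _ c(2) q]
  show "continuous_on {c..b} (\<lambda>x. q x * bessel_J e (of_real (\<omega> * g x)))"
    unfolding continuous_on_eq_continuous_within
  proof
    fix x assume x: "x \<in> {c..b}"
    show "continuous (at x within {c..b}) (\<lambda>x. q x * bessel_J e (of_real (\<omega> * g x)))"
    proof (cases "x = c")
      case True
      then show ?thesis using cont by (simp add: continuous_within)
    next
      case False
      then have "continuous (at x within {a..b}) (\<lambda>x. q x * bessel_J e (of_real (\<omega> * g x)))"
        using x c by (intro has_vector_derivative_continuous[OF D]) auto
      then show ?thesis
        by (rule continuous_within_subset) (use c in auto)
    qed
  qed
  fix x assume x: "x \<in> {c<..<b}"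
  have "at x within {a..b} = at x" using x c by (intro at_within_Icc_at) auto
  then show "((\<lambda>x. q x * bessel_J e (of_real (\<omega> * g x))) has_vector_derivative F x) (at x)"
    using D[of x e] x c F[OF x] by simp
qed

text \<open>As |g| = (x - a)^(r+1) |w|, the integrand is dominated by a multiple of (x - a)^((r+1)
  Re \<mu>), and the hypothesis says precisely that this exponent exceeds -1.\<close>

lemma integrable_bessel_phase:
  assumes s: "continuous_on {a..b} s" and \<mu>: "Re \<mu> > - 1 / (real r + 1)" and "\<omega> \<noteq> 0"
  shows "(\<lambda>x. s x * bessel_J \<mu> (of_real (\<omega> * g x))) integrable_on {a..b}"
proof -
  define p where "p = Re \<mu>"
  have cont: "continuous_on {a<..b} (\<lambda>x. s x * bessel_J \<mu> (of_real (\<omega> * g x)))"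
    by (intro continuous_intros continuous_on_subset[OF s] continuous_on_subset[OF continuous_g])
       (use g_nz \<open>\<omega> \<noteq> 0\<close> in auto)
  obtain S where S: "S \<ge> 0" "\<And>x. x \<in> {a..b} \<Longrightarrow> norm (s x) \<le> S"
    using continuous_on_Icc_bounded[OF s] by blast
  have "continuous_on {a..b} (\<lambda>x. \<omega> * g x)"
    by (intro continuous_intros continuous_g)
  then obtain R where R: "R \<ge> 0" "\<And>x. x \<in> {a..b} \<Longrightarrow> norm (\<omega> * g x) \<le> R"
    using continuous_on_Icc_bounded by blast
  obtain K where K: "K \<ge> 0"
    "\<And>x::real. x \<noteq> 0 \<Longrightarrow> \<bar>x\<bar> \<le> R \<Longrightarrow> norm (bessel_J \<mu> (of_real x)) \<le> K * \<bar>x / 2\<bar> powr p"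
    using bessel_J_local_bound[of R \<mu>] unfolding p_def by blast
  \<comment> \<open>The exponent \<open>p\<close> may be negative, so continuity of this power
    relies on w being nonzero.\<close>
  have "continuous_on {a..b} (\<lambda>x. (\<bar>\<omega> / 2\<bar> * norm (w x)) powr p)"
    using w_nz \<open>\<omega> \<noteq> 0\<close> by (intro continuous_intros continuous_on_powr smooth_on_imp_continuous_on smooth_w) auto
  then obtain W where W: "W \<ge> 0" "\<And>x. x \<in> {a..b} \<Longrightarrow> norm ((\<bar>\<omega> / 2\<bar> * norm (w x)) powr p) \<le> W"
    using continuous_on_Icc_bounded by blast
  have bound: "norm (s x * bessel_J \<mu> (of_real (\<omega> * g x))) \<le> S * (K * W) * (x - a) powr ((real r + 1) * p)"
    if x: "x \<in> {a<..b}" for x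
  proof -
    have xab: "x \<in> {a..b}" using x by auto
    have gx: "\<bar>g x\<bar> = (x - a) ^ Suc r * norm (w x)"
      using arg_cong[OF g_eq[OF xab], of norm] x by (simp only: norm_mult norm_of_real) (simp add: abs_mult)
    have "\<bar>\<omega> * g x / 2\<bar> powr p = ((x - a) ^ Suc r * (\<bar>\<omega> / 2\<bar> * norm (w x))) powr p"
      by (simp add: abs_mult gx mult_ac del: power_Suc)
    also have "\<dots> = ((x - a) ^ Suc r) powr p * (\<bar>\<omega> / 2\<bar> * norm (w x)) powr p"
      by (rule powr_mult)
    also have "((x - a) ^ Suc r) powr p = (x - a) powr ((real r + 1) * p)"
      using x powr_realpow[of "x - a" "Suc r"] powr_powr[of "x - a" "real (Suc r)" p] by (simp add: add_ac)
    also have "(x - a) powr ((real r + 1) * p) * (\<bar>\<omega> / 2\<bar> * norm (w x)) powr p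
        \<le> (x - a) powr ((real r + 1) * p) * W"
      using W(2)[OF xab] by (intro mult_left_mono) auto
    finally have "norm (bessel_J \<mu> (of_real (\<omega> * g x))) \<le> K * ((x - a) powr ((real r + 1) * p) * W)"
      using K(2)[of "\<omega> * g x"] g_nz[OF x] \<open>\<omega> \<noteq> 0\<close> R(2)[OF xab] mult_left_mono[OF _ K(1)]
      by (smt (verit) mult_eq_0_iff real_norm_def)
    then have "norm (s x * bessel_J \<mu> (of_real (\<omega> * g x))) \<le> S * (K * ((x - a) powr ((real r + 1) * p) * W))"
      unfolding norm_mult using S(2)[OF xab] S(1) by (intro mult_mono) auto
    then show ?thesis by (simp add: mult_ac)
  qed
  have p: "(real r + 1) * p > -1"
    using \<mu> by (simp add: p_def field_simps)
  \<comment> \<open>The point a is removed because continuity, hence measurability, is known only on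
    the half-open interval; it is restored as a null set.\<close>
  have "(\<lambda>x. s x * bessel_J \<mu> (of_real (\<omega> * g x))) integrable_on {a<..b}"
  proof (rule measurable_bounded_by_integrable_imp_integrable)
    show "(\<lambda>x. s x * bessel_J \<mu> (of_real (\<omega> * g x))) \<in> borel_measurable (lebesgue_on {a<..b})"
      by (rule continuous_imp_measurable_on_sets_lebesgue[OF cont]) simp
    have "(\<lambda>x. S * (K * W) * (x - a) powr ((real r + 1) * p)) integrable_on {a..b}"
      using integrable_on_powr_shift[OF less_imp_le[OF ab] p] by (rule integrable_on_mult_right)
    then show "(\<lambda>x. S * (K * W) * (x - a) powr ((real r + 1) * p)) integrable_on {a<..b}"
      by (rule integrable_spike_set) (rule negligible_subset[of "{a}"]; auto)+
  qed (use bound in auto)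
  then show ?thesis
    by (rule integrable_spike_set) (rule negligible_subset[of "{a}"]; auto)+
qed

lemma bessel_phase_integral_bound:
  assumes s: "smooth_on {a..b} s" and \<mu>: "Re \<mu> \<ge> 0"
  obtains C \<Omega> where "\<Omega> \<ge> 1"
    "\<And>\<omega>. \<omega> \<ge> \<Omega> \<Longrightarrow> norm (integral {a..b} (\<lambda>x. s x * bessel_J \<mu> (of_real (\<omega> * g x))))
        \<le> C * \<omega> powr (- 1 / (real r + 1))"
proof -
  define e where "e = \<mu> + 1"
  have e1: "e - 1 = \<mu>" by (simp add: e_def)
  define Q where "Q = (\<lambda>x. s x / v x)"
  define Q' where "Q' = hderiv {a..b} 1 Q"
  have Q: "smooth_on {a..b} Q"
    unfolding Q_def using s smooth_v v_nz by (rule smooth_on_divide[OF ab])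
  \<comment> \<open>\<open>N\<close> is the numerator left when q' - e q g' / g is put over (x -
    a)^(r+1), for the \<open>q\<close> defined below.\<close>
  define N where "N = (\<lambda>x. Q' x * of_real (x - a) - of_nat r * Q x - e * (s x / w x))"
  have contN: "continuous_on {a..b} N"
    unfolding N_def Q'_def
    by (intro continuous_intros smooth_on_imp_continuous_on smooth_on_derivative Q s smooth_w) (use w_nz in auto)
  obtain C0 where C0: "C0 \<ge> 0" "\<And>x::real. norm (bessel_J \<mu> (of_real x)) \<le> C0"
    using bessel_J_bounded[OF \<mu>] by blast
  have "Re e \<ge> 0" using \<mu> by (simp add: e_def)
  then obtain C1 where C1: "C1 \<ge> 0" "\<And>x::real. norm (bessel_J e (of_real x)) \<le> C1"
    using bessel_J_bounded by blast
  obtain S where S: "S \<ge> 0" "\<And>x. x \<in> {a..b} \<Longrightarrow> norm (s x) \<le> S"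
    using continuous_on_Icc_bounded[OF smooth_on_imp_continuous_on[OF s]] by blast
  obtain Q0 where Q0: "Q0 \<ge> 0" "\<And>x. x \<in> {a..b} \<Longrightarrow> norm (Q x) \<le> Q0"
    using continuous_on_Icc_bounded[OF smooth_on_imp_continuous_on[OF Q]] by blast
  obtain N0 where N0: "N0 \<ge> 0" "\<And>x. x \<in> {a..b} \<Longrightarrow> norm (N x) \<le> N0"
    using continuous_on_Icc_bounded[OF contN] by blast
  \<comment> \<open>\<omega> \<ge> (b - a)^(-r-1) is equivalent to \<delta> \<le> b - a.\<close>
  define \<Omega> where "\<Omega> = max 1 ((1 / (b - a)) ^ Suc r)"
  \<comment> \<open>\<open>q\<close> = s / g' away from a: a factor 1/\<omega> is gained at the cost
    of a singularity of order r.\<close>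
  define q where "q = (\<lambda>x. Q x / of_real ((x - a) ^ r))"
  define q' where "q' = (\<lambda>x. (Q' x * of_real (x - a) - of_nat r * Q x) / of_real ((x - a) ^ Suc r))"
  have dq: "(q has_vector_derivative q' x) (at x within {a..b})" if x: "x \<in> {a<..b}" for x
  proof -
    have "((\<lambda>x. 1 / (x - a) ^ r) has_real_derivative (- real r / (x - a) ^ Suc r)) (at x within {a..b})"
      using x by (intro DERIV_inverse_power_shift) auto
    then have 1: "((\<lambda>x. complex_of_real (1 / (x - a) ^ r)) has_vector_derivative of_real (- real r / (x - a) ^ Suc r)) (at x within {a..b})"
      by (intro has_vector_derivative_of_real) (simp add: has_real_derivative_iff_has_vector_derivative)
    have 2: "(Q has_vector_derivative Q' x) (at x within {a..b})"
      unfolding Q'_def using x by (intro smooth_on_has_vector_derivative Q) auto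
    have X: "complex_of_real (x - a) \<noteq> 0" using x by simp
    have "Q x * of_real (- real r / (x - a) ^ Suc r) + Q' x * of_real (1 / (x - a) ^ r) = q' x"
      unfolding q'_def of_real_divide of_real_minus of_real_power
      using X by (simp add: field_simps del: of_real_diff)
    moreover have "q = (\<lambda>x. Q x * of_real (1 / (x - a) ^ r))"
      by (simp add: q_def fun_eq_iff)
    ultimately show ?thesis
      using has_vector_derivative_mult[OF 2 1] by simp
  qed
  have far: "norm (of_real \<omega> * integral {a + \<delta>..b} (\<lambda>x. s x * bessel_J \<mu> (of_real (\<omega> * g x))))
      \<le> (2 * Q0 + N0) * C1 * (1 / \<delta> ^ r)"
    if \<delta>: "0 < \<delta>" "\<delta> < b - a" and \<omega>: "\<omega> > 0" for \<delta> \<omega>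
  proof -
    define c where "c = a + \<delta>"
    have c: "c \<in> {a<..b}" "c - a = \<delta>" using \<delta> by (auto simp: c_def)
    let ?P = "\<lambda>x. q x * bessel_J e (of_real (\<omega> * g x))"
    let ?N = "\<lambda>x. N x / of_real ((x - a) ^ Suc r) * bessel_J e (of_real (\<omega> * g x))"
    let ?s = "\<lambda>x. of_real \<omega> * (s x * bessel_J \<mu> (of_real (\<omega> * g x)))"
    have "((\<lambda>x. ?N x + ?s x) has_integral (?P b - ?P c)) {c..b}"
    proof (rule bessel_phase_by_parts[where q' = q'])
      fix x assume "x \<in> {c<..<b}"
      then have x: "x \<in> {a..b}" "x \<in> {a<..b}" using c by auto
      have X: "complex_of_real (x - a) \<noteq> 0" using x by simp
      have qg: "q x * of_real (g' x) = s x"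
        unfolding q_def Q_def g'_eq[OF x(1)] using X v_nz[OF x(1)] by simp
      show "?N x + ?s x = (q' x - e * (q x * of_real (g' x) / of_real (g x))) * bessel_J e (of_real (\<omega> * g x))
       + of_real \<omega> * (q x * of_real (g' x)) * bessel_J (e - 1) (of_real (\<omega> * g x))"
        unfolding qg g_eq[OF x(1)] e1 N_def q'_def of_real_power
        using X w_nz[OF x(1)] by (simp add: field_simps del: of_real_diff)
    next
      have "(?P has_vector_derivative
         (q' c - e * (q c * of_real (g' c) / of_real (g c))) * bessel_J e (of_real (\<omega> * g c))
         + of_real \<omega> * (q c * of_real (g' c)) * bessel_J (e - 1) (of_real (\<omega> * g c))) (at c within {a..b})"
        using c \<omega> by (intro bessel_phase_has_vector_derivative dq) auto
      then have "continuous (at c within {a..b}) ?P"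
        by (rule has_vector_derivative_continuous)
      then have "continuous (at c within {c..b}) ?P"
        by (rule continuous_within_subset) (use c in auto)
      then show "(?P \<longlongrightarrow> ?P c) (at c within {c..b})"
        by (simp add: continuous_within)
    qed (use c \<omega> dq in auto)
    then have tot: "integral {c..b} (\<lambda>x. ?N x + ?s x) = ?P b - ?P c"
      by (rule integral_unique)
    have contJ: "continuous_on {c..b} (\<lambda>x. bessel_J \<mu> (of_real (\<omega> * g x)))" for \<mu>
      by (intro continuous_intros continuous_on_subset[OF continuous_g]) (use c g_nz \<omega> in auto)
    have intN: "?N integrable_on {c..b}"
      by (intro integrable_continuous_interval continuous_intros contJ continuous_on_subset[OF contN]) (use c in auto)
    have ints: "?s integrable_on {c..b}"
      by (intro integrable_continuous_interval continuous_intros contJ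
            continuous_on_subset[OF smooth_on_imp_continuous_on[OF s]]) (use c in auto)
    have split: "of_real \<omega> * integral {c..b} (\<lambda>x. s x * bessel_J \<mu> (of_real (\<omega> * g x))) = ?P b - ?P c - integral {c..b} ?N"
      using tot integral_add[OF intN ints] by (simp add: algebra_simps)
    have Pb: "norm (?P x) \<le> Q0 * C1 * (1 / \<delta> ^ r)" if x: "x \<in> {c..b}" for x
    proof -
      have "norm (?P x) = norm (Q x) * norm (bessel_J e (of_real (\<omega> * g x))) * (1 / (x - a) ^ r)"
        using x c by (simp add: q_def norm_mult norm_divide norm_power del: of_real_diff)
      also have "\<dots> \<le> Q0 * C1 * (1 / \<delta> ^ r)"
        using x c \<delta> by (intro mult_mono Q0 C1 divide_left_mono power_mono mult_nonneg_nonneg) auto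
      finally show ?thesis .
    qed
    \<comment> \<open>Integrating (x - a)^(-r-1) gives \<delta>^(-r), the size of the boundary
      terms. That r \<ge> 1 is used both for this antiderivative and for 1/r \<le> 1 below.\<close>
    have "((\<lambda>x. N0 * C1 * (1 / (x - a) ^ Suc r)) has_integral
        (N0 * C1 * (- 1 / real r * (1 / (b - a) ^ r) - (- 1 / real r * (1 / (c - a) ^ r))))) {c..b}"
    proof (intro has_integral_mult_right fundamental_theorem_of_calculus)
      fix x assume "x \<in> {c..b}"
      then have x: "x > a" using c by auto
      show "((\<lambda>x. - 1 / real r * (1 / (x - a) ^ r)) has_vector_derivative 1 / (x - a) ^ Suc r) (at x within {c..b})"
        unfolding has_real_derivative_iff_has_vector_derivative[symmetric]
        by (rule DERIV_cong[OF DERIV_cmult[OF DERIV_inverse_power_shift]])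
           (use x r in \<open>simp_all del: power_Suc\<close>)
    qed (use c in auto)
    then have hN: "((\<lambda>x. N0 * C1 * (1 / (x - a) ^ Suc r)) has_integral
        (N0 * C1 * (1 / real r * (1 / \<delta> ^ r - 1 / (b - a) ^ r)))) {c..b}"
      by (simp add: c(2) algebra_simps)
    have "norm (integral {c..b} ?N) \<le> integral {c..b} (\<lambda>x. N0 * C1 * (1 / (x - a) ^ Suc r))"
    proof (rule integral_norm_bound_integral[OF intN])
      show "(\<lambda>x. N0 * C1 * (1 / (x - a) ^ Suc r)) integrable_on {c..b}" using hN by blast
      fix x assume x: "x \<in> {c..b}"
      have "norm (?N x) = norm (N x) * norm (bessel_J e (of_real (\<omega> * g x))) * (1 / (x - a) ^ Suc r)"
        using x c by (simp add: norm_mult norm_divide norm_power del: of_real_diff power_Suc)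
      also have "\<dots> \<le> N0 * C1 * (1 / (x - a) ^ Suc r)"
        using x c by (intro mult_mono N0 C1 mult_nonneg_nonneg) auto
      finally show "norm (?N x) \<le> N0 * C1 * (1 / (x - a) ^ Suc r)" .
    qed
    also have "\<dots> = N0 * C1 * (1 / real r * (1 / \<delta> ^ r - 1 / (b - a) ^ r))"
      using hN by (rule integral_unique)
    also have "\<dots> \<le> N0 * C1 * (1 * (1 / \<delta> ^ r))"
    proof (intro mult_left_mono mult_mono)
      show "0 \<le> 1 / \<delta> ^ r - 1 / (b - a) ^ r"
        using \<delta> by (simp add: frac_le power_mono)
    qed (use N0 C1 r ab \<delta> in auto)
    finally have Nb: "norm (integral {c..b} ?N) \<le> N0 * C1 * (1 / \<delta> ^ r)" by simp
    have "norm (?P b - ?P c - integral {c..b} ?N) \<le> norm (?P b) + norm (?P c) + norm (integral {c..b} ?N)"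
      by (meson add_mono norm_triangle_ineq4 order_trans order_refl)
    also have "\<dots> \<le> Q0 * C1 * (1 / \<delta> ^ r) + Q0 * C1 * (1 / \<delta> ^ r) + N0 * C1 * (1 / \<delta> ^ r)"
      using c by (intro add_mono Pb Nb) auto
    finally show ?thesis
      unfolding c_def[symmetric] split by (simp add: algebra_simps)
  qed
  show ?thesis
  proof (rule that[of \<Omega> "S * C0 + (2 * Q0 + N0) * C1"])
    show "\<Omega> \<ge> 1" by (simp add: \<Omega>_def)
    fix \<omega> assume "\<omega> \<ge> \<Omega>"
    then have \<omega>: "\<omega> \<ge> 1" "\<omega> \<ge> (1 / (b - a)) ^ Suc r" by (auto simp: \<Omega>_def)
    define \<delta> where "\<delta> = \<omega> powr (- 1 / (real r + 1))"
    have \<delta>0: "\<delta> > 0" using \<omega> by (simp add: \<delta>_def)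
    have "\<delta> ^ Suc r = \<delta> powr (real r + 1)"
      using powr_realpow[OF \<delta>0, of "Suc r"] by (simp add: add_ac)
    also have "\<dots> = \<omega> powr (- 1)"
      by (simp add: \<delta>_def powr_powr nonzero_divide_eq_eq)
    finally have \<delta>p: "\<delta> ^ Suc r * \<omega> = 1"
      using \<omega> by (simp add: powr_minus_divide)
    have \<delta>1: "\<delta> \<le> b - a"
    proof (rule ccontr)
      assume "\<not> \<delta> \<le> b - a"
      then have "(b - a) ^ Suc r < \<delta> ^ Suc r"
        using ab by (intro power_strict_mono) auto
      then have "(b - a) ^ Suc r * \<omega> < 1"
        using \<delta>p \<omega> by (smt (verit) mult_less_cancel_right)
      moreover have "(b - a) ^ Suc r * \<omega> \<ge> (b - a) ^ Suc r * (1 / (b - a)) ^ Suc r"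
        using \<omega> ab by (intro mult_left_mono) auto
      moreover have "(b - a) ^ Suc r * (1 / (b - a)) ^ Suc r = 1"
        using ab by (simp add: power_divide del: power_Suc)
      ultimately show False by simp
    qed
    let ?f = "\<lambda>x. s x * bessel_J \<mu> (of_real (\<omega> * g x))"
    have "- 1 / (real r + 1) < 0" by simp
    then have "Re \<mu> > - 1 / (real r + 1)" using \<mu> by linarith
    then have int: "?f integrable_on {a..b}"
      using \<omega> by (intro integrable_bessel_phase smooth_on_imp_continuous_on[OF s]) auto
    have near: "norm (integral {a..a + \<delta>} ?f) \<le> S * C0 * \<delta>"
    proof -
      have "norm (integral {a..a + \<delta>} ?f) \<le> integral {a..a + \<delta>} (\<lambda>x. S * C0)"
      proof (rule integral_norm_bound_integral)
        show "?f integrable_on {a..a + \<delta>}"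
          using integrable_on_subinterval[OF int, of a "a + \<delta>"] \<delta>1 by auto
        show "norm (?f x) \<le> S * C0" if "x \<in> {a..a + \<delta>}" for x
          unfolding norm_mult using that \<delta>1 by (intro mult_mono S C0) auto
      qed auto
      then show ?thesis using \<delta>0 by (simp add: mult_ac)
    qed
    have far': "norm (integral {a + \<delta>..b} ?f) \<le> (2 * Q0 + N0) * C1 * \<delta>"
    \<comment> \<open>For \<delta> = b - a the far interval is a single point, which the strict
      inequality in \<open>far\<close> excludes.\<close>
    proof (cases "\<delta> = b - a")
      case True
      then show ?thesis using Q0 N0 C1 ab by simp
    next
      case False
      have "\<omega> * norm (integral {a + \<delta>..b} ?f) \<le> (2 * Q0 + N0) * C1 * (1 / \<delta> ^ r)"
        using far[of \<delta> \<omega>] \<delta>0 \<delta>1 False \<omega> by (simp add: norm_mult)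
      also have "\<dots> = \<omega> * ((2 * Q0 + N0) * C1 * \<delta>)"
        using \<delta>p \<delta>0 by (simp add: field_simps)
      finally show ?thesis using \<omega> by simp
    qed
    have "integral {a..b} ?f = integral {a..a + \<delta>} ?f + integral {a + \<delta>..b} ?f"
      using \<delta>0 \<delta>1 int by (intro Henstock_Kurzweil_Integration.integral_combine[symmetric]) auto
    then have "norm (integral {a..b} ?f) \<le> S * C0 * \<delta> + (2 * Q0 + N0) * C1 * \<delta>"
      using norm_triangle_mono[OF near far'] by simp
    then show "norm (integral {a..b} ?f) \<le> (S * C0 + (2 * Q0 + N0) * C1) * \<omega> powr (- 1 / (real r + 1))"
      by (simp add: \<delta>_def algebra_simps)
  qed
qed

section \<open>Integration by parts against a Taylor remainder\<close>

context
  fixes s u :: "real \<Rightarrow> complex"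
  assumes smooth_s: "smooth_on {a..b} s" and smooth_u: "smooth_on {a..b} u"
    and s_eq: "\<And>x. x \<in> {a..b} \<Longrightarrow> s x = taylorT {a..b} r s x a + of_real ((x - a) ^ Suc r) * u x"
begin

text \<open>The smooth extension to a of (s - T_r s) / g', with r factors x - a cancelled. One
  factor remains, so it vanishes at a.\<close>

definition rem_quot :: "real \<Rightarrow> complex" where "rem_quot = (\<lambda>x. of_real (x - a) * u x / v x)"

lemma smooth_rem_quot: "smooth_on {a..b} rem_quot"
  unfolding rem_quot_def by (intro smooth_on_divide[OF ab] smooth_on_mult[OF ab] smooth_on_linear[OF ab]
      smooth_u smooth_v v_nz)

lemma rem_quot_has_vector_derivative:
  "x \<in> {a..b} \<Longrightarrow> (rem_quot has_vector_derivative hderiv {a..b} 1 rem_quot x) (at x within {a..b})"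
  by (rule smooth_on_has_vector_derivative[OF smooth_rem_quot])

lemma rem_quot_eq:
  assumes "x \<in> {a<..b}"
  shows "rem_quot x = (s x - taylorT {a..b} r s x a) / of_real (g' x)"
proof -
  have x: "x \<in> {a..b}" using assms by auto
  define X where "X = complex_of_real (x - a)"
  have "X \<noteq> 0" using assms by (simp add: X_def)
  moreover have "s x - taylorT {a..b} r s x a = X ^ Suc r * u x"
    using s_eq[OF x] unfolding of_real_power X_def by simp
  ultimately show ?thesis
    unfolding rem_quot_def g'_eq[OF x] of_real_power X_def[symmetric] using v_nz[OF x] by simp
qed

lemma rem_quot_times_g': "x \<in> {a<..b} \<Longrightarrow> rem_quot x * of_real (g' x) = of_real ((x - a) ^ Suc r) * u x"
  using rem_quot_eq[of x] g'_nz[of x] s_eq[of x] by simp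

lemma rem_quot_g'_over_g: "x \<in> {a<..b} \<Longrightarrow> rem_quot x * of_real (g' x) / of_real (g x) = u x / w x"
  using rem_quot_times_g'[of x] g_eq[of x] by (simp del: of_real_diff of_real_power of_real_mult)

text \<open>There is no boundary term at a, because \<open>rem_quot\<close> tends to 0 while J_e is
  bounded; no limit of J_e(\<omega> g) at a is required.\<close>

lemma remainder_integral:
  assumes e: "Re e \<ge> 0" and \<omega>: "\<omega> \<noteq> 0"
  shows "((\<lambda>x. (hderiv {a..b} 1 rem_quot x - e * (u x / w x)) * bessel_J e (of_real (\<omega> * g x))
      + of_real \<omega> * ((s x - taylorT {a..b} r s x a) * bessel_J (e - 1) (of_real (\<omega> * g x)))) has_integral
      rem_quot b * bessel_J e (of_real (\<omega> * g b))) {a..b}"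
proof -
  let ?P = "\<lambda>x. rem_quot x * bessel_J e (of_real (\<omega> * g x))"
  have rem_quot_a: "rem_quot a = 0" by (simp add: rem_quot_def)
  obtain C where C: "C \<ge> 0" "\<And>x::real. norm (bessel_J e (of_real x)) \<le> C"
    using bessel_J_bounded[OF e] by blast
  have "(rem_quot \<longlongrightarrow> rem_quot a) (at a within {a..b})"
    using smooth_on_imp_continuous_on[OF smooth_rem_quot] ab by (simp add: continuous_on_def)
  then have "((\<lambda>x. norm (rem_quot x) * C) \<longlongrightarrow> 0 * C) (at a within {a..b})"
    unfolding rem_quot_a by (intro tendsto_mult_right tendsto_norm_zero)
  then have "((\<lambda>x. norm (rem_quot x) * C) \<longlongrightarrow> 0) (at a within {a..b})" by simp
  moreover have "\<forall>\<^sub>F x in at a within {a..b}. norm (?P x) \<le> norm (rem_quot x) * C"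
    unfolding norm_mult by (intro always_eventually allI mult_left_mono C norm_ge_zero)
  ultimately have lim: "(?P \<longlongrightarrow> 0) (at a within {a..b})"
    by (rule Lim_null_comparison[rotated])
  have "((\<lambda>x. (hderiv {a..b} 1 rem_quot x - e * (u x / w x)) * bessel_J e (of_real (\<omega> * g x))
      + of_real \<omega> * ((s x - taylorT {a..b} r s x a) * bessel_J (e - 1) (of_real (\<omega> * g x)))) has_integral
      ?P b - ?P a) {a..b}"
  proof (intro bessel_phase_by_parts[where q' = "hderiv {a..b} 1 rem_quot"])
    fix x assume "x \<in> {a<..<b}"
    then have x: "x \<in> {a<..b}" "x \<in> {a..b}" by auto
    have "s x - taylorT {a..b} r s x a = rem_quot x * of_real (g' x)"
      using rem_quot_eq[OF x(1)] g'_nz[OF x(1)] by simp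
    then show "(hderiv {a..b} 1 rem_quot x - e * (u x / w x)) * bessel_J e (of_real (\<omega> * g x))
      + of_real \<omega> * ((s x - taylorT {a..b} r s x a) * bessel_J (e - 1) (of_real (\<omega> * g x)))
      = (hderiv {a..b} 1 rem_quot x - e * (rem_quot x * of_real (g' x) / of_real (g x))) * bessel_J e (of_real (\<omega> * g x))
       + of_real \<omega> * (rem_quot x * of_real (g' x)) * bessel_J (e - 1) (of_real (\<omega> * g x))"
      unfolding rem_quot_g'_over_g[OF x(1)] by (simp add: mult.assoc)
  next
    show "(rem_quot has_vector_derivative hderiv {a..b} 1 rem_quot x) (at x within {a..b})" if "x \<in> {a<..b}" for x
      using that by (intro rem_quot_has_vector_derivative) auto
  qed (use ab \<omega> rem_quot_a lim in simp_all)
  then show ?thesis by (simp add: rem_quot_a)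
qed

text \<open>With R = \<open>rem_quot\<close>, the product rule gives g^e (R g^(-e))' = R' - e R g' /
  g away from a, and R g' / g = u / w. The right-hand side is continuous at a and therefore equals
  the limit in the definition.\<close>

lemma sigma_hat_Suc_eq:
  assumes s: "s = sigma_hat a b r \<nu> g k f" and x: "x \<in> {a..b}"
  shows "sigma_hat a b r \<nu> g (Suc k) f x = hderiv {a..b} 1 rem_quot x - (\<nu> + of_nat (Suc k)) * (u x / w x)"
proof -
  define e where "e = \<nu> + of_nat (Suc k)"
  define h where "h = (\<lambda>t. (s t - taylorT {a..b} r s t a) / (complex_of_real (g t) powr e * complex_of_real (g' t)))"
  define F where "F = (\<lambda>t. complex_of_real (g t) powr e * vector_derivative h (at t within {a..b}))"
  define G where "G = (\<lambda>x. hderiv {a..b} 1 rem_quot x - e * (u x / w x))"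
  have sh: "sigma_hat a b r \<nu> g (Suc k) f x = (if x = a then Lim (at_right a) F else F x)"
    by (simp add: s[symmetric] e_def h_def F_def Let_def)
  have FG: "F x = G x" if x: "x \<in> {a<..b}" for x
  proof -
    have xab: "x \<in> {a..b}" using x by auto
    have gx: "g x \<noteq> 0" using g_nz[OF x] .
    have h_eq: "h t = rem_quot t * of_real (g t) powr (- e)" if "t \<in> {a<..b}" for t
      unfolding h_def rem_quot_eq[OF that] powr_minus by (simp add: field_simps)
    from vector_diff_chain_within[OF g_has_vector_derivative[OF xab]
        has_vector_derivative_at_within[OF of_real_powr_has_vector_derivative[OF gx, of "- e"]]]
    have 1: "((\<lambda>t. complex_of_real (g t) powr (- e)) has_vector_derivative
        g' x *\<^sub>R (- e / of_real (g x) * of_real (g x) powr (- e))) (at x within {a..b})"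
      by (simp add: o_def)
    have "(h has_vector_derivative
        rem_quot x * (g' x *\<^sub>R (- e / of_real (g x) * of_real (g x) powr (- e)))
         + hderiv {a..b} 1 rem_quot x * of_real (g x) powr (- e)) (at x within {a..b})"
      using has_vector_derivative_mult[OF rem_quot_has_vector_derivative[OF xab] 1]
    proof (rule has_vector_derivative_transform_within)
      \<comment> \<open>This radius keeps t away from a, where \<open>h\<close> is a division by
        zero.\<close>
      show "0 < x - a" using x by simp
      show "x \<in> {a..b}" by (rule xab)
      fix t assume t: "t \<in> {a..b}" "dist t x < x - a"
      then have "t \<in> {a<..b}" by (auto simp: dist_real_def)
      then show "rem_quot t * of_real (g t) powr (- e) = h t" by (simp add: h_eq)
    qed
    then have "vector_derivative h (at x within {a..b}) =
       rem_quot x * (g' x *\<^sub>R (- e / of_real (g x) * of_real (g x) powr (- e)))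
         + hderiv {a..b} 1 rem_quot x * of_real (g x) powr (- e)"
      by (rule vector_derivative_Icc_eq[OF ab xab])
    then have "F x = hderiv {a..b} 1 rem_quot x - e * (rem_quot x * of_real (g' x) / of_real (g x))"
      using gx by (simp add: F_def powr_minus scaleR_conv_of_real field_simps)
    then show ?thesis unfolding rem_quot_g'_over_g[OF x] G_def .
  qed
  have "continuous_on {a..b} G"
    unfolding G_def
    by (intro continuous_intros smooth_on_imp_continuous_on smooth_on_derivative smooth_rem_quot smooth_u smooth_w)
       (use w_nz in auto)
  then have "(G \<longlongrightarrow> G a) (at a within {a..b})"
    using ab by (simp add: continuous_on_def)
  then have "(G \<longlongrightarrow> G a) (at_right a)"
    using at_within_Icc_at_right[OF ab] by simp
  moreover have "\<forall>\<^sub>F x in at_right a. G x = F x"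
    using eventually_at_right_real[OF ab] by eventually_elim (use FG in auto)
  ultimately have "(F \<longlongrightarrow> G a) (at_right a)"
    using Lim_transform_eventually by blast
  then have "Lim (at_right a) F = G a"
    by (intro tendsto_Lim) auto
  then show ?thesis
    unfolding sh using FG[of x] x by (auto simp: G_def e_def)
qed

end

section \<open>The exact expansion of the oscillatory integral\<close>

lemma smooth_taylor_remainder:
  assumes "smooth_on {a..b} s"
  obtains u where "smooth_on {a..b} u"
    "\<And>x. x \<in> {a..b} \<Longrightarrow> s x = taylorT {a..b} r s x a + of_real ((x - a) ^ Suc r) * u x"
  using Taylor_smooth_remainder[OF ab assms, of "Suc r"]
  unfolding taylorT_def lessThan_Suc_atMost by blast

text \<open>Smoothness at every level, including at a, provides the Taylor cofactor u for the next
  level; a merely continuous extension would stop the recursion.\<close>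

lemma smooth_sigma_hat:
  assumes f: "smooth_on {a..b} f"
  shows "smooth_on {a..b} (sigma_hat a b r \<nu> g k f)"
proof (induction k)
  case (Suc k)
  obtain u where u: "smooth_on {a..b} u"
    "\<And>x. x \<in> {a..b} \<Longrightarrow> sigma_hat a b r \<nu> g k f x =
       taylorT {a..b} r (sigma_hat a b r \<nu> g k f) x a + of_real ((x - a) ^ Suc r) * u x"
    using smooth_taylor_remainder[OF Suc.IH] by blast
  have "smooth_on {a..b} (\<lambda>x. hderiv {a..b} 1 (rem_quot u) x + - (\<nu> + of_nat (Suc k)) * (u x / w x))"
    by (intro smooth_on_add[OF ab] smooth_on_mult[OF ab] smooth_on_const[OF ab] smooth_on_divide[OF ab]
        smooth_on_derivative smooth_rem_quot[OF Suc.IH u] u(1) smooth_w w_nz)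
  then show ?case
    by (rule smooth_on_cong[OF ab]) (simp only: sigma_hat_Suc_eq[OF Suc.IH u refl] diff_conv_add_uminus mult_minus_left)
qed (use f in simp)

text \<open>The Taylor part of \<open>s k\<close> integrates to the moments and the remainder is
  integrated by parts; the resulting identity is solved for \<open>I k\<close>, which produces the
  factors 1/\<omega>.\<close>

lemma sigma_hat_integral_step:
  assumes f: "smooth_on {a..b} f" and \<nu>: "Re \<nu> > - 1 / (real r + 1)" and \<omega>: "\<omega> > 0"
  defines "s \<equiv> \<lambda>k. sigma_hat a b r \<nu> g k f"
  defines "I \<equiv> \<lambda>k. integral {a..b} (\<lambda>x. s k x * bessel_J (\<nu> + of_nat k) (of_real (\<omega> * g x)))"
  shows "I k = (\<Sum>j\<le>r. hderiv {a..b} j (s k) a / of_nat (fact j) * M_mom a b g j (\<nu> + of_nat k) \<omega>)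
     + 1 / of_real \<omega> * ((s k b - taylorT {a..b} r (s k) b a) / of_real (g' b)
         * bessel_J (\<nu> + of_nat (Suc k)) (of_real (\<omega> * g b)))
     - 1 / of_real \<omega> * I (Suc k)"
proof -
  have sm: "smooth_on {a..b} (s k)" for k
    unfolding s_def by (rule smooth_sigma_hat[OF f])
  obtain u where u: "smooth_on {a..b} u"
    "\<And>x. x \<in> {a..b} \<Longrightarrow> s k x = taylorT {a..b} r (s k) x a + of_real ((x - a) ^ Suc r) * u x"
    using smooth_taylor_remainder[OF sm] by blast
  let ?e = "\<nu> + of_nat (Suc k)"
  let ?J = "\<lambda>k x. bessel_J (\<nu> + of_nat k) (of_real (\<omega> * g x))"
  let ?T = "\<lambda>x. taylorT {a..b} r (s k) x a"
  \<comment> \<open>At k = 0 the order may have negative real part, so splitting the integrals rests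
    on this bound and not on boundedness of J.\<close>
  have Re_gt: "Re (\<nu> + of_nat k) > - 1 / (real r + 1)" for k
    using \<nu> by (simp add: less_le_trans)
  have Ree: "Re ?e \<ge> 0"
  proof -
    have "- 1 / (real r + 1) \<ge> -1" by (simp add: field_simps)
    then have "Re \<nu> > - 1" using \<nu> by linarith
    then show ?thesis by simp
  qed
  have int: "(\<lambda>x. q x * ?J k x) integrable_on {a..b}" if "continuous_on {a..b} q" for q k
    using that Re_gt \<omega> by (intro integrable_bessel_phase) auto
  have contT: "continuous_on {a..b} ?T"
    unfolding taylorT_def by (intro continuous_intros)
  have conts: "continuous_on {a..b} (s k)" for k
    by (rule smooth_on_imp_continuous_on[OF sm])
  have "((\<lambda>x. s (Suc k) x * ?J (Suc k) x + of_real \<omega> * ((s k x - ?T x) * ?J k x)) has_integral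
      rem_quot u b * ?J (Suc k) b) {a..b}"
  proof (rule has_integral_eq[OF _ remainder_integral[OF sm u Ree, of \<omega>]])
    fix x assume x: "x \<in> {a..b}"
    have "s (Suc k) x = hderiv {a..b} 1 (rem_quot u) x - ?e * (u x / w x)"
      unfolding s_def by (rule sigma_hat_Suc_eq[OF sm[unfolded s_def] u[unfolded s_def] refl x])
    then show "(hderiv {a..b} 1 (rem_quot u) x - ?e * (u x / w x)) * ?J (Suc k) x
        + of_real \<omega> * ((s k x - ?T x) * bessel_J (?e - 1) (of_real (\<omega> * g x)))
      = s (Suc k) x * ?J (Suc k) x + of_real \<omega> * ((s k x - ?T x) * ?J k x)"
      by (simp add: add_diff_eq[symmetric])
  qed (use \<omega> in simp_all)
  note total = integral_unique[OF this]
  have "(\<lambda>x. s (Suc k) x * ?J (Suc k) x) integrable_on {a..b}"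
    by (rule int[OF conts])
  moreover have "(\<lambda>x. of_real \<omega> * ((s k x - ?T x) * ?J k x)) integrable_on {a..b}"
    by (intro integrable_on_mult_right int continuous_on_diff conts contT)
  ultimately have "integral {a..b} (\<lambda>x. s (Suc k) x * ?J (Suc k) x) + of_real \<omega> * integral {a..b} (\<lambda>x. (s k x - ?T x) * ?J k x)
      = rem_quot u b * ?J (Suc k) b"
    using total by (simp only: integral_add integral_mult_right)
  moreover have "integral {a..b} (\<lambda>x. (s k x - ?T x) * ?J k x) = I k - integral {a..b} (\<lambda>x. ?T x * ?J k x)"
    unfolding I_def left_diff_distrib
    by (rule integral_diff) (intro int conts contT)+
  moreover have "integral {a..b} (\<lambda>x. ?T x * ?J k x)
      = (\<Sum>j\<le>r. hderiv {a..b} j (s k) a / of_nat (fact j) * M_mom a b g j (\<nu> + of_nat k) \<omega>)"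
  proof -
    have "integral {a..b} (\<lambda>x. ?T x * ?J k x)
      = integral {a..b} (\<lambda>x. \<Sum>j\<le>r. hderiv {a..b} j (s k) a / of_nat (fact j) * (of_real ((x - a) ^ j) * ?J k x))"
      by (simp add: taylorT_def sum_distrib_right mult.assoc)
    also have "\<dots> = (\<Sum>j\<le>r. integral {a..b} (\<lambda>x. hderiv {a..b} j (s k) a / of_nat (fact j) * (of_real ((x - a) ^ j) * ?J k x)))"
      by (intro integral_sum integrable_on_mult_right int continuous_intros) auto
    finally show ?thesis
      by (simp add: M_mom_def del: of_real_mult of_real_power)
  qed
  moreover have "rem_quot u b = (s k b - ?T b) / of_real (g' b)"
    using ab by (intro rem_quot_eq[OF sm u]) auto
  ultimately have total': "I (Suc k) + of_real \<omega> * (I k -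
      (\<Sum>j\<le>r. hderiv {a..b} j (s k) a / of_nat (fact j) * M_mom a b g j (\<nu> + of_nat k) \<omega>))
      = (s k b - ?T b) / of_real (g' b) * ?J (Suc k) b"
    unfolding I_def by (simp only:)
  have "x = M + 1 / W * (A' * J) - 1 / W * y"
    if "y + W * (x - M) = A' * J" "W \<noteq> 0" for x y M W A' J :: complex
  proof -
    have y: "y = A' * J - W * (x - M)" using that(1) by (simp add: algebra_simps)
    show ?thesis unfolding y using that(2) by (simp add: field_simps)
  qed
  from this[OF total'] show ?thesis using \<omega> by simp
qed

text \<open>An exact identity for each \<omega> > 0: \<open>QA\<close> collects what m substitutions
  of the step formula leave beside the last integral. Asymptotics enter only in estimating that
  integral.\<close>

lemma H_int_minus_QA:
  assumes f: "smooth_on {a..b} f" and \<nu>: "Re \<nu> > - 1 / (real r + 1)" and \<omega>: "\<omega> > 0"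
  shows "H_int a b \<nu> g f \<omega> - QA a b r \<nu> g m f \<omega> =
    1 / (- of_real \<omega>) ^ m * integral {a..b} (\<lambda>x. sigma_hat a b r \<nu> g m f x
        * bessel_J (\<nu> + of_nat m) (of_real (\<omega> * g x)))"
proof (induction m)
  case 0
  then show ?case by (simp add: H_int_def QA_def)
next
  case (Suc m)
  define z where "z = 1 / (- complex_of_real \<omega>) ^ m"
  have z: "1 / (- complex_of_real \<omega>) ^ Suc m = - z / of_real \<omega>"
    by (simp add: z_def)
  \<comment> \<open>The boundary sum starts at k = 1, so its new term k = m + 1 involves
    \<open>sigma_hat\<close> at level m, the same level as the new moment term.\<close>
  have QA: "QA a b r \<nu> g (Suc m) f \<omega> = QA a b r \<nu> g m f \<omega>
     + z * (\<Sum>j\<le>r. hderiv {a..b} j (sigma_hat a b r \<nu> g m f) a / of_nat (fact j) * M_mom a b g j (\<nu> + of_nat m) \<omega>)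
     - 1 / (- complex_of_real \<omega>) ^ Suc m * ((sigma_hat a b r \<nu> g m f b - taylorT {a..b} r (sigma_hat a b r \<nu> g m f) b a)
          / of_real (g' b)) * bessel_J (\<nu> + of_nat (Suc m)) (of_real (\<omega> * g b))"
    unfolding QA_def z_def by (simp add: sum.atLeast_Suc_atMost_Suc_shift algebra_simps del: power_Suc sigma_hat.simps of_nat_Suc of_real_mult)
  have alg: "H - (Q + z * S - (- z / W) * B * J) = (- z / W) * I'"
    if "H - Q = z * I" "I = S + 1 / W * (B * J) - 1 / W * I'" for H Q S B J I I' W :: complex
  proof -
    have "H = Q + z * I" using that(1) by (simp add: algebra_simps)
    then show ?thesis unfolding that(2) by (simp add: algebra_simps)
  qed
  show ?case
    unfolding QA z
    by (rule alg[OF Suc.IH[folded z_def] sigma_hat_integral_step[OF f \<nu> \<omega>]])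
qed

end

section \<open>Factorisation of the phase at a and the error estimate\<close>

theorem theorem3p5:
  fixes r m :: nat and \<nu> :: complex and a b :: real
    and f :: "real \<Rightarrow> complex" and g :: "real \<Rightarrow> real"
  assumes "r \<ge> 1" and "m \<ge> 1"
    and "Re \<nu> > - 1 / (real r + 1)"
    and "a < b"
    and "smooth_on {a..b} f" and "smooth_on {a..b} g"
    and "g a = 0"
    and "\<forall>j\<in>{1..r}. hderiv {a..b} j g a = 0"
    and "hderiv {a..b} (Suc r) g a \<noteq> 0"
    and "\<forall>x\<in>{a<..b}. g x \<noteq> 0 \<and> hderiv {a..b} 1 g x \<noteq> 0"
  shows "(\<lambda>\<omega>. norm (H_int a b \<nu> g f \<omega> - QA a b r \<nu> g m f \<omega>))
           \<in> O[at_top](\<lambda>\<omega>. \<omega> powr (- real m - 1 / (real r + 1)))"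
proof -
  let ?g = "\<lambda>x. complex_of_real (g x)"
  have ab: "a < b" and sg: "smooth_on {a..b} g" by (rule assms)+
  have sg': "smooth_on {a..b} ?g" by (rule smooth_on_of_real[OF ab sg])
  obtain w where w: "smooth_on {a..b} w" "w a = hderiv {a..b} (Suc r) ?g a / of_nat (fact (Suc r))"
    "\<forall>x\<in>{a..b}. ?g x = (\<Sum>j<Suc r. hderiv {a..b} j ?g a / of_nat (fact j) * of_real ((x - a) ^ j)) + of_real ((x - a) ^ Suc r) * w x"
    using Taylor_smooth_remainder[OF ab sg', of "Suc r"] by blast
  have "hderiv {a..b} j ?g a = 0" if "j < Suc r" for j
  proof (cases "j = 0")
    case True
    then show ?thesis using assms by (simp add: hderiv_0)
  next
    case False
    then show ?thesis using assms(8) that ab by (subst hderiv_of_real[OF ab sg]) auto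
  qed
  then have gw: "?g x = of_real ((x - a) ^ Suc r) * w x" if "x \<in> {a..b}" for x
    using w(3)[rule_format, OF that] by simp
  \<comment> \<open>The cofactor at a is the Taylor coefficient g^(r+1)(a) / (r+1)!, the first that
    does not vanish.\<close>
  have wa: "w a \<noteq> 0"
    unfolding w(2) using assms(9) ab by (subst hderiv_of_real[OF ab sg]) (auto simp del: fact_Suc)
  \<comment> \<open>Read off from the product rule for (x - a)^(r+1) w after taking out (x -
    a)^r.\<close>
  define v where "v = (\<lambda>x. of_nat (Suc r) * w x + of_real (x - a) * hderiv {a..b} 1 w x)"
  have sv: "smooth_on {a..b} v"
    unfolding v_def by (intro smooth_on_add[OF ab] smooth_on_mult[OF ab] smooth_on_const[OF ab]
        smooth_on_linear[OF ab] smooth_on_derivative w)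
  have gv: "of_real (hderiv {a..b} 1 g x) = of_real ((x - a) ^ r) * v x" if x: "x \<in> {a..b}" for x
  proof -
    have "((\<lambda>x. complex_of_real ((x - a) ^ Suc r)) has_vector_derivative of_real (real (Suc r) * (x - a) ^ r)) (at x within {a..b})"
      by (intro has_vector_derivative_of_real)
         (auto intro!: derivative_eq_intros simp: has_real_derivative_iff_has_vector_derivative[symmetric] simp del: power_Suc of_nat_Suc)
    from has_vector_derivative_mult[OF this smooth_on_has_vector_derivative[OF w(1) x]]
    have "((\<lambda>x. of_real ((x - a) ^ Suc r) * w x) has_vector_derivative of_real ((x - a) ^ r) * v x) (at x within {a..b})"
      unfolding of_real_power of_real_mult
      by (rule has_vector_derivative_eq_rhs) (simp add: v_def algebra_simps del: of_real_diff of_nat_Suc)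
    with x gw have "(?g has_vector_derivative of_real ((x - a) ^ r) * v x) (at x within {a..b})"
      by (rule has_vector_derivative_transform)
    then have "vector_derivative ?g (at x within {a..b}) = of_real ((x - a) ^ r) * v x"
      by (rule vector_derivative_Icc_eq[OF ab x])
    moreover have "vector_derivative ?g (at x within {a..b}) = of_real (hderiv {a..b} 1 g x)"
      using hderiv_of_real[OF ab sg x, of 1] hderiv_Suc[of "{a..b}" 0 ?g x] by (simp add: hderiv_0)
    ultimately show ?thesis by simp
  qed
  interpret bessel_phase a b r g v w
  proof
    \<comment> \<open>At a one has v = (r + 1) w, which is nonzero; elsewhere the factorisation of
      g' decides.\<close>
    show "v x \<noteq> 0" if "x \<in> {a..b}" for x
    proof (cases "x = a")
      case True
      then show ?thesis using wa by (simp add: v_def del: of_nat_Suc)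
    next
      case False
      then show ?thesis using gv[OF that] assms(10) that by auto
    qed
    show "w x \<noteq> 0" if "x \<in> {a..b}" for x
      using gw[OF that] assms(10) wa that by (cases "x = a") auto
  qed (fact ab assms(1) sg sv w(1) gw gv)+
  \<comment> \<open>Since Re \<nu> > -1, the condition m \<ge> 1 makes the order of the last
    integral fall in the range where J is bounded.\<close>
  have "Re (\<nu> + of_nat m) \<ge> 0"
  proof -
    have "- 1 / (real r + 1) \<ge> -1" by (simp add: field_simps)
    then have "Re \<nu> > - 1" using assms(3) by linarith
    then show ?thesis using assms(2) by simp
  qed
  from bessel_phase_integral_bound[OF smooth_sigma_hat[OF assms(5)] this]
  obtain C \<Omega> where C: "\<Omega> \<ge> 1" "\<And>\<omega>. \<omega> \<ge> \<Omega> \<Longrightarrow>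
      norm (integral {a..b} (\<lambda>x. sigma_hat a b r \<nu> g m f x * bessel_J (\<nu> + of_nat m) (of_real (\<omega> * g x))))
        \<le> C * \<omega> powr (- 1 / (real r + 1))"
    by metis
  show ?thesis
  proof (rule bigoI[of _ C])
    show "\<forall>\<^sub>F \<omega> in at_top. norm (norm (H_int a b \<nu> g f \<omega> - QA a b r \<nu> g m f \<omega>))
        \<le> C * norm (\<omega> powr (- real m - 1 / (real r + 1)))"
      using eventually_ge_at_top[of \<Omega>]
    proof eventually_elim
      fix \<omega> assume \<omega>: "\<omega> \<ge> \<Omega>"
      then have pos: "\<omega> > 0" using C(1) by simp
      have "norm (H_int a b \<nu> g f \<omega> - QA a b r \<nu> g m f \<omega>)
        = \<omega> powr (- real m) * norm (integral {a..b} (\<lambda>x. sigma_hat a b r \<nu> g m f x * bessel_J (\<nu> + of_nat m) (of_real (\<omega> * g x))))"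
        unfolding H_int_minus_QA[OF assms(5,3) pos] norm_mult
        using pos by (simp add: norm_divide norm_power powr_minus_divide powr_realpow)
      also have "\<dots> \<le> \<omega> powr (- real m) * (C * \<omega> powr (- 1 / (real r + 1)))"
        by (intro mult_left_mono C(2) \<omega>) auto
      also have "\<dots> = C * \<omega> powr (- real m - 1 / (real r + 1))"
        by (simp add: powr_add[symmetric] mult_ac)
      finally show "norm (norm (H_int a b \<nu> g f \<omega> - QA a b r \<nu> g m f \<omega>))
        \<le> C * norm (\<omega> powr (- real m - 1 / (real r + 1)))" by simp
    qed
  qed
qed

end
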